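(* Let $K$ be a field, let $\mathcal{C}$ be a $3$-uniform clutter on $[n]$ and let $\mathcal{C}'$ be a flip of $\mathcal{C}$. Then $\operatorname{reg} I(\bar{\mathcal{C}})=\operatorname{reg} I(\bar{\mathcal{C}'})$, where both ideals are in $S=K[x_1,\dots,x_n]$.
   Context: $[n]=\{1,\dots,n\}$. A $3$-uniform clutter $\mathcal{C}$ on $[n]$ is a set of $3$-element subsets of $[n]$ (called circuits). Its complement $\bar{\mathcal{C}}$ is the set of all $3$-subsets of $[n]$ not in $\mathcal{C}$. For a clutter $\mathcal{D}$ on $[n]$, $I(\mathcal{D})=(\prod_{i\in F}x_i : F\in\mathcal{D})\subset S$. Flip: Let $\mathcal{C}$ be a $3$-uniform clutter on $[n]$. Assume (up to naming of vertices) that $\{1,2,3\},\{1,2,4\}\in\mathcal{C}$ are the only circuits of $\mathcal{C}$ containing $\{1,2\}$ and that no circuit of $\mathcal{C}$ contains $\{3,4\}$. Then $\mathcal{C}'=\big(\mathcal{C}\cup\{\{1,3,4\},\{2,3,4\}\}\big)\setminus\{\{1,2,3\},\{1,2,4\}\}$ is called a flip of $\mathcal{C}$. For a nonzero homogeneous ideal $I\subset S$, $\operatorname{reg}(I)=\sup\{j-i : \beta^S_{i,j}(I)\neq0\}$ is the Castelnuovo-Mumford regularity, where $\beta^S_{i,j}(I)$ are the graded Betti numbers of $I$ as an $S$-module. *)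

theory Defs
  imports
    "HOL-Algebra.Ideal"
    "HOL-Library.Poly_Mapping"
    "HOL-Library.Extended_Real"
    "Jordan_Normal_Form.Matrix"
begin

section \<open>The polynomial ring in finitely many variables\<close>

text \<open>A monomial is its exponent vector, a polynomial the finitely supported map from monomials to
  coefficients; the product of \<^typ>\<open>'a \<Rightarrow>\<^sub>0 'b\<close> is then the product of polynomials. Only the
  variables with index in \<open>{1..n}\<close> may occur in elements of \<open>poly_ring n\<close>.\<close>

type_synonym 'k mpoly = "(nat \<Rightarrow>\<^sub>0 nat) \<Rightarrow>\<^sub>0 'k"

definition poly_ring :: "nat \<Rightarrow> 'k::field mpoly ring" where
  "poly_ring n =
     \<lparr>carrier = {p. \<forall>m \<in> Poly_Mapping.keys p. Poly_Mapping.keys m \<subseteq> {1..n}},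
      monoid.mult = (*), one = 1, zero = 0, add = (+)\<rparr>"

definition indet :: "nat \<Rightarrow> 'k::field mpoly" where
  "indet i = Poly_Mapping.single (Poly_Mapping.single i 1) 1"

definition irrelevant_ideal :: "nat \<Rightarrow> 'k::field mpoly set" where
  "irrelevant_ideal n = Idl\<^bsub>poly_ring n\<^esub> (indet ` {1..n})"

definition total_degree :: "(nat \<Rightarrow>\<^sub>0 nat) \<Rightarrow> nat" where
  "total_degree m = (\<Sum>i \<in> Poly_Mapping.keys m. Poly_Mapping.lookup m i)"

text \<open>The zero polynomial is homogeneous of every degree, and it is the only polynomial that is
  homogeneous of a negative degree.\<close>

definition homogeneous :: "int \<Rightarrow> 'k::field mpoly \<Rightarrow> bool" where
  "homogeneous t p \<longleftrightarrow> (\<forall>m \<in> Poly_Mapping.keys p. int (total_degree m) = t)"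


section \<open>Minimal graded free resolutions, Betti numbers, regularity\<close>

text \<open>The free module of rank \<open>r\<close> over \<open>poly_ring n\<close>.\<close>

definition free_mod :: "nat \<Rightarrow> nat \<Rightarrow> 'k::field mpoly vec set" where
  "free_mod n r = {v \<in> carrier_vec r. \<forall>k < r. v $ k \<in> carrier (poly_ring n)}"

text \<open>With \<open>S = poly_ring n\<close>, the data \<open>(r, a, e, d)\<close> describe the complex
  \<open>\<dots> \<rightarrow> F\<^sub>2 \<rightarrow> F\<^sub>1 \<rightarrow> F\<^sub>0 \<rightarrow> I \<rightarrow> 0\<close> in which \<open>F\<^sub>i\<close> is the direct sum of the modules \<open>S(- a i k)\<close> for
  \<open>k < r i\<close>, that is, its \<open>k\<close>-th basis element has degree \<open>a i k\<close>. The map \<open>F\<^sub>0 \<rightarrow> I\<close> sends the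
  \<open>k\<close>-th basis element to \<open>e $ k\<close>, and \<open>d i\<close> is the matrix of \<open>F\<^sub>i\<^sub>+\<^sub>1 \<rightarrow> F\<^sub>i\<close>. The homogeneity
  conditions say that all maps preserve degrees. Only the values \<open>a i k\<close> with \<open>k < r i\<close> matter.\<close>

definition graded_free_resolution ::
  "nat \<Rightarrow> 'k::field mpoly set \<Rightarrow> (nat \<Rightarrow> nat) \<Rightarrow> (nat \<Rightarrow> nat \<Rightarrow> int) \<Rightarrow>
   'k mpoly vec \<Rightarrow> (nat \<Rightarrow> 'k mpoly mat) \<Rightarrow> bool" where
  "graded_free_resolution n I r a e d \<longleftrightarrow>
     e \<in> free_mod n (r 0) \<and>
     (\<forall>k < r 0. homogeneous (a 0 k) (e $ k)) \<and>
     (\<forall>i. d i \<in> carrier_mat (r i) (r (Suc i)) \<and>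
        (\<forall>k < r i. \<forall>l < r (Suc i).
           d i $$ (k, l) \<in> carrier (poly_ring n) \<and>
           homogeneous (a (Suc i) l - a i k) (d i $$ (k, l)))) \<and>
     (\<lambda>v. e \<bullet> v) ` free_mod n (r 0) = I \<and>
     {v \<in> free_mod n (r 0). e \<bullet> v = 0} = (\<lambda>v. d 0 *\<^sub>v v) ` free_mod n (r 1) \<and>
     (\<forall>i. {v \<in> free_mod n (r (Suc i)). d i *\<^sub>v v = 0\<^sub>v (r i)} =
            (\<lambda>v. d (Suc i) *\<^sub>v v) ` free_mod n (r (Suc (Suc i))))"

text \<open>Minimality: the image of \<open>F\<^sub>i\<^sub>+\<^sub>1\<close> lies in the product of the irrelevant ideal and \<open>F\<^sub>i\<close>.\<close>

definition minimal_graded_free_resolution ::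
  "nat \<Rightarrow> 'k::field mpoly set \<Rightarrow> (nat \<Rightarrow> nat) \<Rightarrow> (nat \<Rightarrow> nat \<Rightarrow> int) \<Rightarrow>
   'k mpoly vec \<Rightarrow> (nat \<Rightarrow> 'k mpoly mat) \<Rightarrow> bool" where
  "minimal_graded_free_resolution n I r a e d \<longleftrightarrow>
     graded_free_resolution n I r a e d \<and>
     (\<forall>i. \<forall>k < r i. \<forall>l < r (Suc i). d i $$ (k, l) \<in> irrelevant_ideal n)"

text \<open>The number of summands \<open>S(-j)\<close> in step \<open>i\<close> of a minimal graded free resolution of \<open>I\<close> as a
  module over \<open>poly_ring n\<close>. For a homogeneous ideal such a resolution exists and is unique up to
  isomorphism, so this is well defined; for other \<open>I\<close> the value is irrelevant.\<close>

definition graded_betti :: "nat \<Rightarrow> 'k::field mpoly set \<Rightarrow> nat \<Rightarrow> int \<Rightarrow> nat" where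
  "graded_betti n I i j =
     (THE b. \<exists>r a e d. minimal_graded_free_resolution n I r a e d \<and> b = card {k. k < r i \<and> a i k = j})"

text \<open>The supremum is taken in the extended reals, so it is a genuine supremum in every case.\<close>

definition regularity :: "nat \<Rightarrow> 'k::field mpoly set \<Rightarrow> ereal" where
  "regularity n I = Sup {ereal (real_of_int (j - int i)) | i j. graded_betti n I i j \<noteq> 0}"


section \<open>Clutters and flips\<close>

definition triples :: "nat \<Rightarrow> nat set set" where
  "triples n = {F. F \<subseteq> {1..n} \<and> card F = 3}"

definition uniform3_clutter :: "nat \<Rightarrow> nat set set \<Rightarrow> bool" where
  "uniform3_clutter n C \<longleftrightarrow> C \<subseteq> triples n"

definition clutter_complement :: "nat \<Rightarrow> nat set set \<Rightarrow> nat set set" where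
  "clutter_complement n C = triples n - C"

definition circuit_ideal :: "nat \<Rightarrow> nat set set \<Rightarrow> 'k::field mpoly set" where
  "circuit_ideal n D = Idl\<^bsub>poly_ring n\<^esub> ((\<lambda>F. \<Prod>i \<in> F. indet i) ` D)"

definition is_flip :: "nat set set \<Rightarrow> nat set set \<Rightarrow> bool" where
  "is_flip C C' \<longleftrightarrow>
     (\<exists>p q s t. distinct [p, q, s, t] \<and>
        {F \<in> C. {p, q} \<subseteq> F} = {{p, q, s}, {p, q, t}} \<and>
        (\<forall>F \<in> C. \<not> {s, t} \<subseteq> F) \<and>
        C' = (C \<union> {{p, s, t}, {q, s, t}}) - {{p, q, s}, {p, q, t}})"

end

theory Submission
  imports Defs "Jordan_Normal_Form.Determinant"
begin

text \<open>
  Let \<open>\<D>\<close> be a set of subsets of \<open>{1..n}\<close>, and call \<open>G \<subseteq> {1..n}\<close> a nonface if it contains a member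
  of \<open>\<D>\<close>. For \<open>W \<subseteq> {1..n}\<close> the functions on the nonfaces inside \<open>W\<close> form, with the simplicial
  coboundary, the cochain complex of the full simplex on \<open>W\<close> relative to the subcomplex of faces. By
  a form of Hochster's formula, the Betti numbers of the squarefree ideal \<open>I\<close> generated by \<open>\<D>\<close> are the
  dimensions of its cohomology: in degree \<open>W\<close> and homological degree \<open>i\<close> one finds the cohomology at
  nonfaces of size \<open>card W - i\<close>. Hence the regularity of \<open>I\<close> is the supremum of all sizes \<open>s\<close> at which
  the complex of some \<open>W\<close> is not exact (\<open>regularity_circuit_ideal\<close>).

  It remains to see that a flip does not change this set of sizes (\<open>nonexact_degrees_flip\<close>). Let
  \<open>{p, q, s}\<close>, \<open>{p, q, t}\<close> be exchanged for \<open>{p, s, t}\<close>, \<open>{q, s, t}\<close>. For sets of at least four elements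
  being a nonface is the same before and after the flip, so from size \<open>5\<close> on nothing changes at all.
  Sizes below \<open>3\<close> never occur, and size \<open>3\<close> always does, because some triple is a nonface. At size \<open>4\<close> the
  cocycles agree and only the coboundaries change. Let \<open>E\<close> be the span of the coboundaries of the
  indicators of the common nonfaces in \<open>W\<close>; its elements vanish at \<open>{p, q, s, t}\<close>. Applying the
  coboundary twice to the indicator of \<open>{s, t}\<close> before and of \<open>{p, q}\<close> after the flip gives a relation which
  shows that the space of coboundaries is \<open>E\<close>, both before and after, if \<open>{p, q, s, t}\<close> is not contained in \<open>W\<close>, and
  otherwise is spanned by \<open>E\<close> and one element that does not vanish at \<open>{p, q, s, t}\<close>. So if every
  cocycle is a coboundary before the flip, the same is true after it.

  The algebra consists of two facts. A minimal graded free resolution with squarefree degrees exists: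
  squarefree modules over the polynomial ring correspond to functors from the lattice of subsets of
  \<open>{1..n}\<close> to vector spaces, here nested systems of subspaces of a fixed coordinate space. Each has
  finitely many minimal generators, the syzygies form a nested system again
  (\<open>squarefree_resolution_exists\<close>), and a monomial matrix turns each step into a map of free modules
  (\<open>minimal_graded_free_resolution_circuit_ideal\<close>). Dimension shifting along this resolution gives
  Hochster's formula (\<open>generator_iff_not_exact\<close>). And the Betti numbers do not depend on the resolution
  (\<open>graded_betti_eq\<close>): comparison maps between two minimal resolutions are mutually inverse modulo
  the irrelevant ideal.
\<close>

section \<open>Nested systems of subspaces and their minimal generators\<close>

definition coord_subspace :: "(nat \<Rightarrow> 'k::field) set \<Rightarrow> bool" where
  "coord_subspace V \<longleftrightarrow> (\<lambda>_. 0) \<in> V \<and> (\<forall>f\<in>V. \<forall>g\<in>V. (\<lambda>k. f k + g k) \<in> V) \<and>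
     (\<forall>c. \<forall>f\<in>V. (\<lambda>k. c * f k) \<in> V)"

lemma coord_subspaceD:
  assumes "coord_subspace V"
  shows coord_subspace_0: "(\<lambda>_. 0) \<in> V"
    and coord_subspace_add: "f \<in> V \<Longrightarrow> g \<in> V \<Longrightarrow> (\<lambda>k. f k + g k) \<in> V"
    and coord_subspace_scale: "f \<in> V \<Longrightarrow> (\<lambda>k. c * f k) \<in> V"
  using assms by (auto simp: coord_subspace_def)

lemma coord_subspace_diff:
  assumes "coord_subspace V" "f \<in> V" "g \<in> V"
  shows "(\<lambda>k. f k - g k) \<in> V"
  using coord_subspace_add[OF assms(1,2) coord_subspace_scale[OF assms(1,3), of "-1"]] by simp

lemma coord_subspace_sum:
  assumes "coord_subspace V" "\<And>i. i \<in> I \<Longrightarrow> f i \<in> V"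
  shows "(\<lambda>k. \<Sum>i\<in>I. c i * f i k) \<in> V"
  using assms(2)
proof (induction I rule: infinite_finite_induct)
  case (insert i I)
  have "(\<lambda>k. c i * f i k + (\<Sum>i\<in>I. c i * f i k)) \<in> V"
    using coord_subspace_add[OF assms(1) coord_subspace_scale[OF assms(1), of "f i" "c i"]] insert by blast
  then show ?case using insert by simp
qed (use coord_subspace_0[OF assms(1)] in auto)

text \<open>The map from a free module with basis indexed by \<open>{..<r}\<close> that sends the
  \<open>k\<close>-th basis vector to \<open>g k\<close>; source and target are given in
  coordinates.\<close>

definition comb :: "nat \<Rightarrow> (nat \<Rightarrow> nat \<Rightarrow> 'k::field) \<Rightarrow> (nat \<Rightarrow> 'k) \<Rightarrow> nat \<Rightarrow> 'k" where
  "comb r g f = (\<lambda>m. \<Sum>k<r. f k * g k m)"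

lemma comb_diff: "comb r g (\<lambda>k. f k - h k) = (\<lambda>m. comb r g f m - comb r g h m)"
  by (simp add: comb_def sum_subtractf left_diff_distrib)

lemma comb_scale: "comb r g (\<lambda>k. c * f k) = (\<lambda>m. c * comb r g f m)"
  by (simp add: comb_def sum_distrib_left mult.assoc)

lemma comb_add: "comb r g (\<lambda>k. f k + h k) = (\<lambda>m. comb r g f m + comb r g h m)"
  by (simp add: comb_def sum.distrib distrib_right)

text \<open>Gaussian elimination on the last coordinate.\<close>

lemma coord_subspace_finitely_spanned:
  assumes "coord_subspace V" "\<forall>f\<in>V. \<forall>k\<ge>N. f k = 0"
  shows "\<exists>m b. (\<forall>j<m. b j \<in> V) \<and> (\<forall>v\<in>V. \<exists>c. comb m b c = v)"
  using assms
proof (induction N arbitrary: V)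
  case 0
  then have "\<forall>v\<in>V. v = (\<lambda>_. 0)" by auto
  then show ?case by (intro exI[of _ 0]) (auto simp: comb_def)
next
  case (Suc N)
  note V = Suc.prems(1)
  let ?V' = "{f\<in>V. f N = 0}"
  have "coord_subspace ?V'" using V by (auto simp: coord_subspace_def)
  moreover have "\<forall>f\<in>?V'. \<forall>k\<ge>N. f k = 0"
    using Suc.prems(2) by (metis (mono_tags, lifting) Suc_leI le_neq_implies_less mem_Collect_eq)
  ultimately obtain m b where b: "\<forall>j<m. b j \<in> ?V'" "\<forall>v\<in>?V'. \<exists>c. comb m b c = v"
    using Suc.IH by blast
  show ?case
  proof (cases "\<forall>f\<in>V. f N = 0")
    case True
    then have "?V' = V" by auto
    then show ?thesis using b by auto
  next
    case False
    then obtain f0 where f0: "f0 \<in> V" "f0 N \<noteq> 0" by auto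
    define b' where "b' j = (if j < m then b j else f0)" for j
    have "\<exists>c. comb (Suc m) b' c = v" if "v \<in> V" for v
    proof -
      define w where "w = (\<lambda>k. v k - v N / f0 N * f0 k)"
      have "w \<in> ?V'"
        using coord_subspace_diff[OF V that coord_subspace_scale[OF V f0(1), of "v N / f0 N"]] f0(2) by (simp add: w_def)
      then obtain c where c: "comb m b c = w" using b(2) by blast
      have "comb (Suc m) b' (\<lambda>j. if j < m then c j else v N / f0 N) i = v i" for i
      proof -
        have "comb (Suc m) b' (\<lambda>j. if j < m then c j else v N / f0 N) i
            = comb m b c i + v N / f0 N * f0 i"
          by (simp add: comb_def b'_def)
        then show ?thesis by (simp add: c w_def)
      qed
      then show ?thesis by blast
    qed
    moreover have "\<forall>j<Suc m. b' j \<in> V" using b(1) f0(1) by (auto simp: b'_def)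
    ultimately show ?thesis by blast
  qed
qed

text \<open>The value \<open>M W\<close> is the part of a squarefree module in the degrees with support
  \<open>W\<close>; the multiplication maps between these parts become inclusions. Squarefree ideals
  and all their modules of syzygies have this form.\<close>

definition nested_system :: "nat \<Rightarrow> nat \<Rightarrow> (nat set \<Rightarrow> (nat \<Rightarrow> 'k::field) set) \<Rightarrow> bool" where
  "nested_system n N M \<longleftrightarrow>
     (\<forall>W\<subseteq>{1..n}. coord_subspace (M W) \<and> (\<forall>f\<in>M W. \<forall>k\<ge>N. f k = 0)) \<and>
     (\<forall>V W. V \<subseteq> W \<longrightarrow> W \<subseteq> {1..n} \<longrightarrow> M V \<subseteq> M W)"

text \<open>The free module whose \<open>k\<close>-th basis element has the squarefree degree \<open>A
  k\<close>.\<close>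

definition free_system :: "nat \<Rightarrow> (nat \<Rightarrow> nat set) \<Rightarrow> nat set \<Rightarrow> (nat \<Rightarrow> 'k::field) set" where
  "free_system r A W = {f. \<forall>k. f k \<noteq> 0 \<longrightarrow> k < r \<and> A k \<subseteq> W}"

definition syzygies ::
  "nat \<Rightarrow> (nat \<Rightarrow> nat set) \<Rightarrow> (nat \<Rightarrow> nat \<Rightarrow> 'k::field) \<Rightarrow> nat set \<Rightarrow> (nat \<Rightarrow> 'k) set" where
  "syzygies r A g W = {f \<in> free_system r A W. \<forall>m. comb r g f m = 0}"

definition generates ::
  "nat \<Rightarrow> (nat set \<Rightarrow> (nat \<Rightarrow> 'k::field) set) \<Rightarrow>
   nat \<Rightarrow> (nat \<Rightarrow> nat set) \<Rightarrow> (nat \<Rightarrow> nat \<Rightarrow> 'k) \<Rightarrow> bool" where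
  "generates n M r A g \<longleftrightarrow> (\<forall>k<r. A k \<subseteq> {1..n} \<and> g k \<in> M (A k)) \<and>
     (\<forall>W\<subseteq>{1..n}. \<forall>v\<in>M W. \<exists>f\<in>free_system r A W. comb r g f = v)"

text \<open>By the second condition no relation has a unit among its coefficients, which is the form of
  minimality that minimal resolutions require.\<close>

definition generates_minimally ::
  "nat \<Rightarrow> (nat set \<Rightarrow> (nat \<Rightarrow> 'k::field) set) \<Rightarrow>
   nat \<Rightarrow> (nat \<Rightarrow> nat set) \<Rightarrow> (nat \<Rightarrow> nat \<Rightarrow> 'k) \<Rightarrow> bool" where
  "generates_minimally n M r A g \<longleftrightarrow> generates n M r A g \<and>
     (\<forall>W\<subseteq>{1..n}. \<forall>f\<in>syzygies r A g W. \<forall>k. A k = W \<longrightarrow> f k = 0)"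

lemma coord_subspace_free_system: "coord_subspace (free_system r A W)"
proof -
  have "k < r \<and> A k \<subseteq> W"
    if "f \<in> free_system r A W" "h \<in> free_system r A W" "f k + h k \<noteq> 0" for f h k
    using that by (cases "f k = 0") (auto simp: free_system_def)
  then show ?thesis by (auto simp: coord_subspace_def free_system_def)
qed

lemma nested_system_syzygies: "nested_system n r (syzygies r A g)"
proof -
  have "coord_subspace (syzygies r A g W)" for W
    using coord_subspace_free_system[of r A W] comb_add[of r g] comb_scale[of r g]
    by (auto simp: coord_subspace_def syzygies_def comb_def[of _ _ "\<lambda>_. 0"])
  moreover have "\<forall>f\<in>syzygies r A g W. \<forall>k\<ge>r. f k = 0" for W
    by (auto simp: syzygies_def free_system_def)
  moreover have "syzygies r A g V \<subseteq> syzygies r A g W" if "V \<subseteq> W" for V W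
    using that by (auto simp: syzygies_def free_system_def)
  ultimately show ?thesis by (simp add: nested_system_def)
qed

lemma comb_free_system_mem:
  assumes M: "nested_system n N M" and gen: "generates n M r A g"
    and W: "W \<subseteq> {1..n}" and f: "f \<in> free_system r A W"
  shows "comb r g f \<in> M W"
proof -
  have sub: "coord_subspace (M W)" using M W by (simp add: nested_system_def)
  have eq: "comb r g f = (\<lambda>m. \<Sum>k\<in>{k. k < r \<and> A k \<subseteq> W}. f k * g k m)"
    unfolding comb_def using f by (intro ext sum.mono_neutral_right) (auto simp: free_system_def)
  have "g k \<in> M W" if "k \<in> {k. k < r \<and> A k \<subseteq> W}" for k
  proof -
    have "g k \<in> M (A k)" using that gen by (simp add: generates_def)
    moreover have "M (A k) \<subseteq> M W" using that M W by (simp add: nested_system_def)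
    ultimately show ?thesis by blast
  qed
  then show ?thesis unfolding eq by (intro coord_subspace_sum[OF sub]) auto
qed

text \<open>There are only finitely many degrees \<open>W\<close>, so spanning sets of all the \<open>M
  W\<close> together generate.\<close>

lemma finitely_generated:
  assumes M: "nested_system n N M"
  shows "\<exists>r A g. generates n M r A g"
proof -
  have "\<exists>r A g. (\<forall>k<r. A k \<subseteq> {1..n} \<and> g k \<in> M (A k)) \<and>
     (\<forall>W\<in>X. \<forall>v\<in>M W. \<exists>f\<in>free_system r A W. comb r g f = v)"
    if "finite X" "X \<subseteq> Pow {1..n}" for X
    using that
  proof (induction X)
    case empty
    show ?case by (intro exI[of _ 0]) auto
  next
    case (insert V X)
    then obtain r A g where IH: "\<forall>k<r. A k \<subseteq> {1..n} \<and> g k \<in> M (A k)"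
      "\<forall>W\<in>X. \<forall>v\<in>M W. \<exists>f\<in>free_system r A W. comb r g f = v" by auto
    have V: "V \<subseteq> {1..n}" using insert by auto
    then obtain m b where b: "\<forall>j<m. b j \<in> M V" "\<forall>v\<in>M V. \<exists>c. comb m b c = v"
      using coord_subspace_finitely_spanned[of "M V" N] M by (auto simp: nested_system_def)
    define A' where "A' k = (if k < r then A k else V)" for k
    define g' where "g' k = (if k < r then g k else b (k - r))" for k
    have 1: "\<forall>k<r + m. A' k \<subseteq> {1..n} \<and> g' k \<in> M (A' k)"
      using IH(1) b(1) V by (auto simp: A'_def g'_def)
    have split: "comb (r + m) g' f i = comb r g f i + comb m b (\<lambda>j. f (r + j)) i" for f i
    proof -
      have "(\<Sum>k<r + m. f k * g' k i) = (\<Sum>k<r. f k * g' k i) + (\<Sum>j<m. f (r + j) * g' (r + j) i)"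
        by (induction m) (auto simp: add.assoc)
      then show ?thesis by (simp add: comb_def g'_def)
    qed
    have "\<exists>f\<in>free_system (r + m) A' W. comb (r + m) g' f = v" if W: "W \<in> insert V X" "v \<in> M W" for W v
    proof (cases "W = V")
      case True
      then obtain c where c: "comb m b c = v" using W b(2) by auto
      let ?f = "\<lambda>k. if r \<le> k \<and> k < r + m then c (k - r) else 0"
      have "?f \<in> free_system (r + m) A' W" using True by (auto simp: free_system_def A'_def)
      moreover have "comb (r + m) g' ?f i = v i" for i
        unfolding split using c by (auto simp: comb_def)
      ultimately show ?thesis by blast
    next
      case False
      then obtain f where f: "f \<in> free_system r A W" "comb r g f = v" using W IH(2) by auto
      have "f \<in> free_system (r + m) A' W" using f(1) by (fastforce simp: free_system_def A'_def)
      moreover have "f (r + j) = 0" for j using f(1) by (auto simp: free_system_def)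
      then have "comb (r + m) g' f i = v i" for i
        unfolding split using f(2) by (simp add: comb_def)
      ultimately show ?thesis by blast
    qed
    then show ?case using 1 by blast
  qed
  from this[of "Pow {1..n}"] show ?thesis unfolding generates_def by (simp add: Ball_def Pow_def)
qed

text \<open>A generating family of least length is minimal: a relation that involves a generator in its own
  degree with a nonzero coefficient expresses that generator by the others.\<close>

lemma minimal_generators_exist:
  assumes M: "nested_system n N M"
  shows "\<exists>r A g. generates_minimally n M r A g"
proof -
  let ?P = "\<lambda>r. \<exists>A g. generates n M r A g"
  have ex: "\<exists>r. ?P r" using finitely_generated[OF M] .
  define r where "r = (LEAST r. ?P r)"
  obtain A g where gen: "generates n M r A g" using LeastI_ex[OF ex] by (auto simp: r_def)
  have least: "r \<le> r'" if "generates n M r' A' g'" for r' A' g'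
    unfolding r_def using that by (intro Least_le) blast
  have "f k = 0" if W: "W \<subseteq> {1..n}" and f: "f \<in> syzygies r A g W" and k: "A k = W" for W f k
  proof (rule ccontr)
    assume fk: "f k \<noteq> 0"
    then have kr: "k < r" using f by (auto simp: syzygies_def free_system_def)
    \<comment> \<open>the enumeration of the indices below \<open>r\<close> that skips \<open>k\<close>\<close>
    define s where "s j = (if j < k then j else Suc j)" for j
    have bij: "bij_betw s {..<r - 1} ({..<r} - {k})"
    proof (rule bij_betw_imageI)
      show "inj_on s {..<r - 1}" by (auto simp: inj_on_def s_def split: if_splits)
      have "j \<in> s ` {..<r - 1}" if "j < r" "j \<noteq> k" for j
        by (rule image_eqI[of _ _ "if j < k then j else j - 1"]) (use that kr in \<open>auto simp: s_def\<close>)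
      moreover have "s j < r" "s j \<noteq> k" if "j < r - 1" for j
        using that kr by (auto simp: s_def)
      ultimately show "s ` {..<r - 1} = {..<r} - {k}" by blast
    qed
    have "\<exists>h\<in>free_system (r - 1) (A \<circ> s) V. comb (r - 1) (g \<circ> s) h = v"
      if V: "V \<subseteq> {1..n}" and v: "v \<in> M V" for V v
    proof -
      obtain h0 where h0: "h0 \<in> free_system r A V" "comb r g h0 = v"
        using gen V v unfolding generates_def by blast
      define h where "h = (\<lambda>j. h0 j - h0 k / f k * f j)"
      have hv: "comb r g h = v"
        unfolding h_def comb_diff comb_scale using f h0(2) by (simp add: syzygies_def)
      have hk: "h k = 0" using fk by (simp add: h_def)
      have h: "h \<in> free_system r A V"
      proof (cases "h0 k = 0")
        case True
        then show ?thesis using h0(1) by (simp add: h_def)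
      next
        case False
        then have "W \<subseteq> V" using h0(1) k by (auto simp: free_system_def)
        then have "f \<in> free_system r A V" using f by (auto simp: syzygies_def free_system_def)
        then show ?thesis unfolding h_def
          by (intro coord_subspace_diff coord_subspace_scale coord_subspace_free_system h0(1))
      qed
      let ?h = "\<lambda>j. if j < r - 1 then h (s j) else 0"
      have "?h \<in> free_system (r - 1) (A \<circ> s) V" using h by (auto simp: free_system_def)
      moreover have "comb (r - 1) (g \<circ> s) ?h i = v i" for i
      proof -
        have "comb (r - 1) (g \<circ> s) ?h i = (\<Sum>j<r - 1. h (s j) * g (s j) i)"
          unfolding comb_def by (intro sum.cong) auto
        also have "\<dots> = (\<Sum>j\<in>{..<r} - {k}. h j * g j i)"
          using sum.reindex_bij_betw[OF bij, of "\<lambda>j. h j * g j i"] by simp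
        also have "\<dots> = comb r g h i"
          unfolding comb_def by (rule sum.mono_neutral_left) (use hk in auto)
        finally show ?thesis using hv by simp
      qed
      ultimately show ?thesis by blast
    qed
    moreover have "(A \<circ> s) j \<subseteq> {1..n} \<and> (g \<circ> s) j \<in> M ((A \<circ> s) j)" if "j < r - 1" for j
      using gen bij_betwE[OF bij] that unfolding generates_def by auto
    ultimately have "generates n M (r - 1) (A \<circ> s) (g \<circ> s)" unfolding generates_def by blast
    from least[OF this] kr show False by simp
  qed
  then show ?thesis using gen unfolding generates_minimally_def by blast
qed

text \<open>The module \<open>M 0\<close>, given inside \<open>N\<close> coordinates, with successive minimal
  generators; \<open>M (Suc i)\<close> consists of the relations between the generators of \<open>M
  i\<close>.\<close>

locale squarefree_resolution =
  fixes n N :: nat and M :: "nat \<Rightarrow> nat set \<Rightarrow> (nat \<Rightarrow> 'k::field) set"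
    and r :: "nat \<Rightarrow> nat" and A :: "nat \<Rightarrow> nat \<Rightarrow> nat set" and g :: "nat \<Rightarrow> nat \<Rightarrow> nat \<Rightarrow> 'k"
  assumes nested_0: "nested_system n N (M 0)"
    and minimal: "generates_minimally n (M i) (r i) (A i) (g i)"
    and M_Suc: "M (Suc i) = syzygies (r i) (A i) (g i)"
begin

lemma generating: "generates n (M i) (r i) (A i) (g i)"
  using minimal by (simp add: generates_minimally_def)

lemma nested: "\<exists>N. nested_system n N (M i)"
  using nested_0 nested_system_syzygies[of n] by (cases i) (simp_all only: M_Suc, blast+)

lemma M_coord_subspace: "W \<subseteq> {1..n} \<Longrightarrow> coord_subspace (M i W)"
  using nested[of i] by (auto simp: nested_system_def)

lemma A_subset: "k < r i \<Longrightarrow> A i k \<subseteq> {1..n}"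
  using generating[of i] by (simp add: generates_def)

lemma g_mem: "k < r i \<Longrightarrow> g i k \<in> M i (A i k)"
  using generating[of i] by (simp add: generates_def)

lemma comb_mem: "W \<subseteq> {1..n} \<Longrightarrow> f \<in> free_system (r i) (A i) W \<Longrightarrow> comb (r i) (g i) f \<in> M i W"
  using comb_free_system_mem generating nested by blast

lemma comb_lift:
  "W \<subseteq> {1..n} \<Longrightarrow> v \<in> M i W \<Longrightarrow> \<exists>f\<in>free_system (r i) (A i) W. comb (r i) (g i) f = v"
  using generating[of i] by (simp add: generates_def)

lemma syzygy_eq_0: "W \<subseteq> {1..n} \<Longrightarrow> f \<in> M (Suc i) W \<Longrightarrow> A i k = W \<Longrightarrow> f k = 0"
  using minimal[of i] by (simp add: generates_minimally_def M_Suc)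

lemma g_Suc_strict:
  assumes l: "l < r (Suc i)" and "g (Suc i) l k \<noteq> 0"
  shows "k < r i" "A i k \<subset> A (Suc i) l"
proof -
  have "g (Suc i) l \<in> M (Suc i) (A (Suc i) l)" using g_mem l by blast
  moreover from this have "A i k \<noteq> A (Suc i) l" using syzygy_eq_0 A_subset l assms(2) by blast
  ultimately show "k < r i" "A i k \<subset> A (Suc i) l"
    using assms(2) by (auto simp: M_Suc syzygies_def free_system_def)
qed

lemma g_nonzero:
  assumes k: "k < r i"
  shows "\<exists>m. g i k m \<noteq> 0"
proof (rule ccontr)
  assume "\<not> ?thesis"
  then have "(\<lambda>j. if j = k then 1 else 0) \<in> M (Suc i) (A i k)"
    using k by (auto simp: M_Suc syzygies_def free_system_def comb_def if_distrib[of "\<lambda>x. x * _"] cong: if_cong)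
  then show False using syzygy_eq_0[OF A_subset[OF k]] by fastforce
qed

text \<open>Degrees grow strictly along the resolution.\<close>

lemma le_card_A: "k < r i \<Longrightarrow> i \<le> card (A i k)"
proof (induction i arbitrary: k)
  case (Suc i)
  obtain m where "g (Suc i) k m \<noteq> 0" using g_nonzero Suc.prems by blast
  then have "m < r i" "A i m \<subset> A (Suc i) k" using g_Suc_strict Suc.prems by blast+
  moreover have "finite (A (Suc i) k)" using A_subset[OF Suc.prems] finite_subset by blast
  ultimately show ?case using Suc.IH[of m] psubset_card_mono[of "A (Suc i) k" "A i m"] by simp
qed simp

end

text \<open>Minimal generators are chosen one step after the other; the relations between them are a nested
  system, so the construction never stops being possible.\<close>

lemma squarefree_resolution_exists:
  fixes M0 :: "nat set \<Rightarrow> (nat \<Rightarrow> 'a::field) set"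
  assumes "nested_system n N M0"
  shows "\<exists>M r A g. squarefree_resolution n N M r A g \<and> M 0 = M0"
proof -
  define P :: "nat \<Rightarrow> _ \<times> nat \<times> (nat \<Rightarrow> nat set) \<times> (nat \<Rightarrow> nat \<Rightarrow> 'a) \<Rightarrow> bool" where
    "P i = (\<lambda>(M, r, A, g). (i = 0 \<longrightarrow> M = M0) \<and> (\<exists>N. nested_system n N M) \<and>
              generates_minimally n M r A g)" for i
  define Q :: "nat \<Rightarrow> (nat set \<Rightarrow> (nat \<Rightarrow> 'a) set) \<times> nat \<times> (nat \<Rightarrow> nat set) \<times> (nat \<Rightarrow> nat \<Rightarrow> 'a) \<Rightarrow>
                _ \<times> nat \<times> (nat \<Rightarrow> nat set) \<times> (nat \<Rightarrow> nat \<Rightarrow> 'a) \<Rightarrow> bool" where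
    "Q i = (\<lambda>(M, r, A, g) (M', r', A', g'). M' = syzygies r A g)" for i
  have "\<exists>F. \<forall>i. P i (F i) \<and> Q i (F i) (F (Suc i))"
  proof (rule dependent_nat_choice)
    show "\<exists>x. P 0 x" using minimal_generators_exist[OF assms] assms by (auto simp: P_def)
    fix x :: "(nat set \<Rightarrow> (nat \<Rightarrow> 'a) set) \<times> nat \<times> (nat \<Rightarrow> nat set) \<times> (nat \<Rightarrow> nat \<Rightarrow> 'a)"
    fix i :: nat
    obtain M r A g where x: "x = (M, r, A, g)" by (cases x)
    show "\<exists>y. P (Suc i) y \<and> Q i x y"
      using minimal_generators_exist[OF nested_system_syzygies[of n r A g]] nested_system_syzygies[of n r A g]
      by (auto simp: x P_def Q_def)
  qed
  then obtain F where F: "\<And>i. P i (F i)" "\<And>i. Q i (F i) (F (Suc i))" by blast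
  let ?M = "\<lambda>i. fst (F i)" and ?r = "\<lambda>i. fst (snd (F i))"
    and ?A = "\<lambda>i. fst (snd (snd (F i)))" and ?g = "\<lambda>i. snd (snd (snd (F i)))"
  have "?M 0 = M0" using F(1)[of 0] by (auto simp: P_def case_prod_beta)
  moreover have "squarefree_resolution n N ?M ?r ?A ?g"
    using F(1) F(2) assms \<open>?M 0 = M0\<close>
    by unfold_locales (auto simp: P_def Q_def case_prod_beta)
  ultimately show ?thesis by (metis (no_types, lifting))
qed

section \<open>The Koszul complex of a nested system\<close>

definition pos_sign :: "nat \<Rightarrow> nat set \<Rightarrow> 'k::field" where
  "pos_sign u G = (- 1) ^ card {v \<in> G. v < u}"

text \<open>The simplicial coboundary, with the sign of \<open>u\<close> given by its position in
  \<open>G\<close>.\<close>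

definition cobd :: "(nat set \<Rightarrow> 'k::field) \<Rightarrow> nat set \<Rightarrow> 'k" where
  "cobd z G = (\<Sum>u\<in>G. pos_sign u G * z (G - {u}))"

lemma pos_sign_remove:
  assumes "finite G" "v \<in> G"
  shows "(pos_sign u G :: 'k::field) = (if v < u then - pos_sign u (G - {v}) else pos_sign u (G - {v}))"
proof (cases "v < u")
  case True
  have "{w \<in> G. w < u} = insert v {w \<in> G - {v}. w < u}" using True assms by auto
  moreover have "finite {w \<in> G - {v}. w < u}" using assms by auto
  ultimately have "card {w \<in> G. w < u} = Suc (card {w \<in> G - {v}. w < u})" by simp
  then show ?thesis using True by (simp add: pos_sign_def)
next
  case False
  then have "{w \<in> G. w < u} = {w \<in> G - {v}. w < u}" by auto
  then show ?thesis using False by (simp add: pos_sign_def)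
qed

lemma pos_sign_remove_self: "pos_sign u (G - {u}) = pos_sign u G"
  unfolding pos_sign_def by (rule arg_cong[where f = "\<lambda>X. (- 1) ^ card X"]) auto

lemma pos_sign_square [simp]: "pos_sign u G * pos_sign u G = 1"
  unfolding pos_sign_def by (simp flip: power_add mult_2)

lemma pos_sign_square' [simp]: "pos_sign u G * (pos_sign u G * x) = x"
  by (simp flip: mult.assoc)

lemma pos_sign_nonzero [simp]: "pos_sign u G \<noteq> 0"
  by (simp add: pos_sign_def)

lemma pos_sign_swap:
  assumes "finite G" "u \<in> G" "v \<in> G" "u \<noteq> v"
  shows "pos_sign u G * pos_sign v (G - {u}) = - (pos_sign v G * pos_sign u (G - {v}) :: 'k::field)"
  using assms pos_sign_remove[of G v u, where ?'k = 'k] pos_sign_remove[of G u v, where ?'k = 'k]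
  by (auto simp: not_less)

text \<open>The terms cancel in pairs; halving the sum would not cover characteristic two.\<close>

lemma sum_antisymmetric:
  fixes T :: "'a \<Rightarrow> 'a \<Rightarrow> 'b::ab_group_add"
  assumes "finite G" "\<And>u v. u \<in> G \<Longrightarrow> v \<in> G \<Longrightarrow> u \<noteq> v \<Longrightarrow> T u v = - T v u"
  shows "(\<Sum>u\<in>G. \<Sum>v\<in>G - {u}. T u v) = 0"
  using assms
proof (induction G)
  case (insert x G)
  have "(\<Sum>v\<in>insert x G - {u}. T u v) = T u x + (\<Sum>v\<in>G - {u}. T u v)" if "u \<in> G" for u
    using that insert.hyps by (subst insert_Diff_if) auto
  then have "(\<Sum>u\<in>G. \<Sum>v\<in>insert x G - {u}. T u v)
      = (\<Sum>u\<in>G. T u x) + (\<Sum>u\<in>G. \<Sum>v\<in>G - {u}. T u v)"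
    by (simp add: sum.distrib cong: sum.cong)
  also have "(\<Sum>u\<in>G. \<Sum>v\<in>G - {u}. T u v) = 0" by (rule insert.IH) (rule insert.prems, auto)
  finally have "(\<Sum>u\<in>G. \<Sum>v\<in>insert x G - {u}. T u v) = (\<Sum>u\<in>G. T u x)" by simp
  moreover have "(\<Sum>v\<in>insert x G - {x}. T x v) = (\<Sum>v\<in>G. - T v x)"
  proof (rule sum.cong)
    show "insert x G - {x} = G" using insert.hyps by auto
    fix v assume "v \<in> G"
    then have "x \<noteq> v" using insert.hyps by auto
    with \<open>v \<in> G\<close> show "T x v = - T v x" by (intro insert.prems) auto
  qed
  ultimately show ?case using insert.hyps by (simp add: sum_negf)
qed simp

lemma cobd_cobd:
  assumes "finite G"
  shows "cobd (cobd z) G = 0"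
proof -
  have "cobd (cobd z) G
      = (\<Sum>u\<in>G. \<Sum>v\<in>G - {u}. pos_sign u G * pos_sign v (G - {u}) * z (G - {u} - {v}))"
    by (simp add: cobd_def sum_distrib_left mult.assoc)
  also have "\<dots> = 0"
  proof (rule sum_antisymmetric[OF assms])
    fix u v assume "u \<in> G" "v \<in> G" "u \<noteq> v"
    moreover have "G - {u} - {v} = G - {v} - {u}" by auto
    ultimately show "pos_sign u G * pos_sign v (G - {u}) * z (G - {u} - {v})
        = - (pos_sign v G * pos_sign u (G - {v}) * z (G - {v} - {u}))"
      using pos_sign_swap[OF assms, of u v, where ?'k = 'a] by simp
  qed
  finally show ?thesis .
qed

lemma cobd_cong:
  "(\<And>H. H \<subset> G \<Longrightarrow> y H = z H) \<Longrightarrow> cobd y G = cobd z G"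
  unfolding cobd_def by (intro sum.cong refl arg_cong2[where f = "(*)"]) auto

lemma cobd_diff: "cobd (\<lambda>H. y H - z H) G = cobd y G - cobd z G"
  by (simp add: cobd_def right_diff_distrib sum_subtractf)

lemma cobd_add: "cobd (\<lambda>H. y H + z H) G = cobd y G + cobd z G"
  by (simp add: cobd_def distrib_left sum.distrib)

lemma cobd_scale: "cobd (\<lambda>H. c * z H) G = c * cobd z G"
  by (simp add: cobd_def sum_distrib_left mult.left_commute)

lemma cobd_0 [simp]: "cobd (\<lambda>H. 0) G = 0"
  by (simp add: cobd_def)

lemma cobd_truncate:
  assumes "finite G"
  shows "cobd (\<lambda>H. if Suc (card H) = s then z H else 0) G = (if card G = s then cobd z G else 0)"
proof -
  have "Suc (card (G - {u})) = card G" if "u \<in> G" for u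
    using assms that by (metis card_Suc_Diff1)
  then show ?thesis by (auto simp: cobd_def intro!: sum.cong sum.neutral)
qed

text \<open>Adding a fixed vertex \<open>u\<close> to the argument is a contracting homotopy of the cochain
  complex of a full simplex.\<close>

lemma cobd_contraction:
  assumes fin: "finite W" and u: "u \<in> W" and cocycle: "\<forall>G\<subseteq>W. cobd z G = 0" and G: "G \<subseteq> W"
  shows "cobd (\<lambda>H. if u \<in> H then 0 else pos_sign u H * z (insert u H)) G = z G"
proof -
  let ?y = "\<lambda>H. if u \<in> H then 0 else pos_sign u H * z (insert u H)"
  have finG: "finite G" using fin G finite_subset by blast
  show ?thesis
  proof (cases "u \<in> G")
    case True
    have "cobd ?y G = (\<Sum>v\<in>G. if v = u then z G else 0)"
      unfolding cobd_def
      by (intro sum.cong refl) (use True in \<open>auto simp: pos_sign_remove_self insert_absorb\<close>)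
    also have "\<dots> = z G" using True finG by simp
    finally show ?thesis .
  next
    case False
    let ?H = "insert u G"
    have H: "?H - {u} = G" "finite ?H" using False finG by auto
    have summand: "pos_sign v G * ?y (G - {v}) = - pos_sign u ?H * (pos_sign v ?H * z (?H - {v}))"
      if v: "v \<in> G" for v
    proof -
      have ne: "u \<noteq> v" using v False by auto
      then have ins: "insert u (G - {v}) = ?H - {v}" by auto
      have "pos_sign u (G - {v}) = (pos_sign u (?H - {v}) :: 'a)"
        using pos_sign_remove_self[of u "?H - {v}", where ?'a = 'a] False ne
        by (simp add: insert_Diff_if Diff_insert0 cong: if_cong)
      moreover have "pos_sign u ?H * pos_sign v G = - (pos_sign v ?H * pos_sign u (?H - {v}) :: 'a)"
        using pos_sign_swap[OF H(2), of u v, where ?'k = 'a] v ne H(1) by simp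
      then have "pos_sign v G = - (pos_sign u ?H * pos_sign v ?H * pos_sign u (?H - {v}) :: 'a)"
        by (metis (no_types, lifting) mult.assoc mult_minus_right pos_sign_square')
      ultimately show ?thesis using False ins by simp
    qed
    have "cobd z ?H = pos_sign u ?H * z G + (\<Sum>v\<in>G. pos_sign v ?H * z (?H - {v}))"
      unfolding cobd_def using False finG H(1) by simp
    moreover have "cobd z ?H = 0" using cocycle u G by auto
    ultimately have "(\<Sum>v\<in>G. pos_sign v ?H * z (?H - {v})) = - (pos_sign u ?H * z G)"
      by (simp add: eq_neg_iff_add_eq_0 add.commute)
    moreover have "cobd ?y G = (\<Sum>v\<in>G. - pos_sign u ?H * (pos_sign v ?H * z (?H - {v})))"
      unfolding cobd_def by (rule sum.cong[OF refl summand])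
    then have "cobd ?y G = - pos_sign u ?H * (\<Sum>v\<in>G. pos_sign v ?H * z (?H - {v}))"
      by (simp only: sum_distrib_left)
    ultimately show ?thesis by simp
  qed
qed

text \<open>The Koszul complex of \<open>M\<close> in the squarefree degree \<open>W\<close> has as its term
  in homological degree \<open>p\<close> the sum of the spaces \<open>M G\<close> over \<open>G
  \<subseteq> W\<close> with \<open>card G = card W - p\<close>. Exactness is expressed at the sets
  of size \<open>s\<close>. The primitive \<open>y\<close> may have entries at sets of any size;
  those of a size other than \<open>s - 1\<close> can be discarded by \<open>cobd_truncate\<close>.\<close>

definition koszul_exact :: "(nat set \<Rightarrow> (nat \<Rightarrow> 'k::field) set) \<Rightarrow> nat set \<Rightarrow> nat \<Rightarrow> bool" where
  "koszul_exact M W s \<longleftrightarrow>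
     (\<forall>z. (\<forall>G\<subseteq>W. z G \<in> M G) \<longrightarrow> (\<forall>G\<subseteq>W. card G \<noteq> s \<longrightarrow> z G = (\<lambda>_. 0)) \<longrightarrow>
          (\<forall>G\<subseteq>W. \<forall>k. cobd (\<lambda>H. z H k) G = 0) \<longrightarrow>
          (\<exists>y. (\<forall>G\<subseteq>W. y G \<in> M G) \<and> (\<forall>G\<subseteq>W. \<forall>k. cobd (\<lambda>H. y H k) G = z G k)))"

lemma koszul_exactD:
  assumes "koszul_exact M W s" "\<And>G. G \<subseteq> W \<Longrightarrow> z G \<in> M G"
    "\<And>G. G \<subseteq> W \<Longrightarrow> card G \<noteq> s \<Longrightarrow> z G = (\<lambda>_. 0)"
    "\<And>G k. G \<subseteq> W \<Longrightarrow> cobd (\<lambda>H. z H k) G = 0"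
  obtains y where "\<And>G. G \<subseteq> W \<Longrightarrow> y G \<in> M G"
    "\<And>G k. G \<subseteq> W \<Longrightarrow> cobd (\<lambda>H. y H k) G = z G k"
proof -
  have "\<exists>y. (\<forall>G\<subseteq>W. y G \<in> M G) \<and> (\<forall>G\<subseteq>W. \<forall>k. cobd (\<lambda>H. y H k) G = z G k)"
  proof (rule assms(1)[unfolded koszul_exact_def, THEN spec, THEN mp, THEN mp, THEN mp])
    show "\<forall>G\<subseteq>W. z G \<in> M G" using assms(2) by simp
    show "\<forall>G\<subseteq>W. card G \<noteq> s \<longrightarrow> z G = (\<lambda>_. 0)" using assms(3) by simp
    show "\<forall>G\<subseteq>W. \<forall>k. cobd (\<lambda>H. z H k) G = 0" using assms(4) by simp
  qed
  then obtain y where "\<forall>G\<subseteq>W. y G \<in> M G" "\<forall>G\<subseteq>W. \<forall>k. cobd (\<lambda>H. y H k) G = z G k"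
    by (elim exE conjE)
  then show ?thesis by (intro that[of y]) simp_all
qed

lemma comb_cobd: "comb r g (\<lambda>k. cobd (\<lambda>H. y H k) G) m = cobd (\<lambda>H. comb r g (y H) m) G"
proof -
  have "comb r g (\<lambda>k. cobd (\<lambda>H. y H k) G) m
      = (\<Sum>k<r. \<Sum>u\<in>G. pos_sign u G * (y (G - {u}) k * g k m))"
    by (simp add: comb_def cobd_def sum_distrib_right mult.assoc)
  also have "\<dots> = (\<Sum>u\<in>G. \<Sum>k<r. pos_sign u G * (y (G - {u}) k * g k m))"
    by (rule sum.swap)
  finally show ?thesis by (simp add: comb_def cobd_def sum_distrib_left)
qed

text \<open>If the degree of a basis element is properly contained in \<open>W\<close>, it omits some vertex
  of \<open>W\<close>, and \<open>cobd_contraction\<close> for this vertex contracts its part of the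
  complex. Only the basis elements of degree \<open>W\<close> contribute cohomology, and they do so
  at \<open>W\<close> itself.\<close>

lemma free_system_contraction:
  fixes z :: "nat set \<Rightarrow> nat \<Rightarrow> 'k::field"
  assumes fin: "finite W" and z: "\<And>G. G \<subseteq> W \<Longrightarrow> z G \<in> free_system r A G"
    and cocycle: "\<And>G k. G \<subseteq> W \<Longrightarrow> cobd (\<lambda>H. z H k) G = 0"
    and top: "\<And>k. A k = W \<Longrightarrow> z W k = 0"
  obtains y where "\<And>G. G \<subseteq> W \<Longrightarrow> y G \<in> free_system r A G"
    "\<And>G k. G \<subseteq> W \<Longrightarrow> cobd (\<lambda>H. y H k) G = z G k"
proof -
  define u where "u k = (SOME u. u \<in> W - A k)" for k
  have u: "u k \<in> W - A k" if "A k \<subset> W" for k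
    unfolding u_def by (rule someI_ex) (use that in blast)
  define y where "y G k = (if A k \<subset> W then
      if u k \<in> G then 0 else pos_sign (u k) G * z (insert (u k) G) k else 0)" for G k
  have "y G \<in> free_system r A G" if G: "G \<subseteq> W" for G
    unfolding free_system_def
  proof (clarify)
    fix k assume "y G k \<noteq> 0"
    then have k: "A k \<subset> W" "u k \<notin> G" "z (insert (u k) G) k \<noteq> 0"
      by (auto simp: y_def split: if_splits)
    have "insert (u k) G \<subseteq> W" using u[OF k(1)] G by blast
    from z[OF this] have "k < r \<and> A k \<subseteq> insert (u k) G"
      using k(3) by (simp add: free_system_def)
    then show "k < r \<and> A k \<subseteq> G" using u[OF k(1)] by blast
  qed
  moreover have "cobd (\<lambda>H. y H k) G = z G k" if G: "G \<subseteq> W" for G k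
  proof (cases "A k \<subset> W")
    case True
    then show ?thesis
      using cobd_contraction[OF fin _ _ G, of "u k" "\<lambda>H. z H k"] u[OF True] cocycle
      by (simp add: y_def)
  next
    case False
    have "z G k = 0"
    proof (rule ccontr)
      assume nz: "z G k \<noteq> 0"
      then have "A k \<subseteq> G" using z G by (auto simp: free_system_def)
      then have "A k = W" "G = W" using False G by auto
      then show False using top nz by simp
    qed
    then show ?thesis using False by (simp add: y_def)
  qed
  ultimately show ?thesis using that by blast
qed

context squarefree_resolution
begin

lemma lift_cochain:
  assumes W: "W \<subseteq> {1..n}" and z: "\<And>G. G \<subseteq> W \<Longrightarrow> z G \<in> M i G"
  shows "\<exists>z'. \<forall>G. (G \<subseteq> W \<longrightarrow> z' G \<in> free_system (r i) (A i) G \<and> comb (r i) (g i) (z' G) = z G) \<and>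
    (z G = (\<lambda>_. 0) \<longrightarrow> z' G = (\<lambda>_. 0))"
proof -
  have "\<forall>G\<in>Pow W. \<exists>f. f \<in> free_system (r i) (A i) G \<and> comb (r i) (g i) f = z G"
    using comb_lift z W by (meson PowD dual_order.trans)
  then obtain f where f: "\<forall>G\<in>Pow W. f G \<in> free_system (r i) (A i) G \<and> comb (r i) (g i) (f G) = z G"
    by (rule bchoice[THEN exE])
  show ?thesis
    by (intro exI[of _ "\<lambda>G. if z G = (\<lambda>_. 0) then (\<lambda>_. 0) else f G"])
      (use f in \<open>auto simp: free_system_def comb_def\<close>)
qed

text \<open>The long exact cohomology sequence of \<open>0 \<rightarrow> M (Suc i) \<rightarrow> F
  \<rightarrow> M i \<rightarrow> 0\<close> with \<open>F\<close> free, chased by hand. Cohomology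
  of \<open>F\<close> at \<open>W\<close> does not interfere, because by minimality the elements of
  \<open>M (Suc i) W\<close> have no coefficient at the generators of degree \<open>W\<close>.\<close>

lemma koszul_exact_shift:
  assumes W: "W \<subseteq> {1..n}" and s: "s < card W"
  shows "koszul_exact (M i) W s \<longleftrightarrow> koszul_exact (M (Suc i)) W (Suc s)"
proof
  let ?F = "free_system (r i) (A i)" and ?c = "comb (r i) (g i)"
  have finW: "finite W" using W finite_subset by blast
  have fin: "finite G" if "G \<subseteq> W" for G using finW that finite_subset by blast
  have sub1: "G \<subseteq> {1..n}" if "G \<subseteq> W" for G using W that by blast
  have M_free: "f \<in> ?F G" "?c f = (\<lambda>_. 0)" if "f \<in> M (Suc i) G" for f G
    using that by (auto simp: M_Suc syzygies_def)
  have free_M: "f \<in> M (Suc i) G" if "f \<in> ?F G" "\<And>m. ?c f m = 0" for f G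
    using that by (auto simp: M_Suc syzygies_def)
  {
    assume ex: "koszul_exact (M i) W s"
    show "koszul_exact (M (Suc i)) W (Suc s)"
      unfolding koszul_exact_def
    proof (intro allI impI)
      fix z assume "\<forall>G\<subseteq>W. z G \<in> M (Suc i) G" and z0: "\<forall>G\<subseteq>W. card G \<noteq> Suc s \<longrightarrow> z G = (\<lambda>_. 0)"
        and cocycle: "\<forall>G\<subseteq>W. \<forall>k. cobd (\<lambda>H. z H k) G = 0"
      then have z: "z G \<in> M (Suc i) G" if "G \<subseteq> W" for G using that by blast
      obtain y0 where y0: "\<And>G. G \<subseteq> W \<Longrightarrow> y0 G \<in> ?F G"
        "\<And>G k. G \<subseteq> W \<Longrightarrow> cobd (\<lambda>H. y0 H k) G = z G k"
      proof (rule free_system_contraction[OF finW, of z "r i" "A i"])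
        show "z W k = 0" if "A i k = W" for k using syzygy_eq_0[OF W z that] by simp
      qed (use z M_free cocycle in auto)
      define y where "y G = (if Suc (card G) = Suc s then y0 G else (\<lambda>_. 0))" for G
      have y: "y G \<in> ?F G" if "G \<subseteq> W" for G
        using y0(1)[OF that] by (auto simp: y_def free_system_def)
      have cobd_y: "cobd (\<lambda>H. y H k) G = z G k" if "G \<subseteq> W" for G k
      proof -
        have "(\<lambda>H. y H k) = (\<lambda>H. if Suc (card H) = Suc s then y0 H k else 0)"
          by (auto simp: y_def)
        then have "cobd (\<lambda>H. y H k) G = (if card G = Suc s then z G k else 0)"
          using cobd_truncate[OF fin[OF that], of "Suc s" "\<lambda>H. y0 H k"] y0(2)[OF that] by simp
        then show ?thesis using z0 that by auto
      qed
      obtain x where x: "\<And>G. G \<subseteq> W \<Longrightarrow> x G \<in> M i G"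
        "\<And>G k. G \<subseteq> W \<Longrightarrow> cobd (\<lambda>H. x H k) G = ?c (y G) k"
      proof (rule koszul_exactD[OF ex, of "\<lambda>G. ?c (y G)"])
        show "?c (y G) \<in> M i G" if "G \<subseteq> W" for G using comb_mem[OF sub1 y] that by blast
        show "?c (y G) = (\<lambda>_. 0)" if "card G \<noteq> s" for G using that by (simp add: y_def comb_def)
        show "cobd (\<lambda>H. ?c (y H) k) G = 0" if "G \<subseteq> W" for G k
        proof -
          have "cobd (\<lambda>H. ?c (y H) k) G = ?c (z G) k"
            using cobd_y[OF that] by (simp flip: comb_cobd)
          then show ?thesis using M_free(2)[OF z[OF that]] by simp
        qed
      qed blast
      obtain x' where "\<forall>G. (G \<subseteq> W \<longrightarrow> x' G \<in> ?F G \<and> ?c (x' G) = x G) \<and>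
          (x G = (\<lambda>_. 0) \<longrightarrow> x' G = (\<lambda>_. 0))"
        using lift_cochain[OF W x(1)] by (rule exE)
      then have x': "x' G \<in> ?F G" "?c (x' G) = x G" if "G \<subseteq> W" for G
        using that by simp_all
      define y' where "y' G k = y G k - cobd (\<lambda>H. x' H k) G" for G k
      have x'_mem: "(\<lambda>k. cobd (\<lambda>H. x' H k) G) \<in> ?F G" if "G \<subseteq> W" for G
        unfolding cobd_def
      proof (rule coord_subspace_sum[OF coord_subspace_free_system])
        show "x' (G - {u}) \<in> ?F G" for u
          using x'(1)[of "G - {u}"] that by (auto simp: free_system_def)
      qed
      have "y' G \<in> M (Suc i) G" if "G \<subseteq> W" for G
      proof (rule free_M)
        show "y' G \<in> ?F G"
          unfolding y'_def by (intro coord_subspace_diff coord_subspace_free_system y x'_mem that)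
        have "cobd (\<lambda>H. ?c (x' H) m) G = cobd (\<lambda>H. x H m) G" for m
          by (rule cobd_cong) (use x'(2) that in auto)
        then show "?c (y' G) m = 0" for m
          using x(2)[OF that] unfolding y'_def comb_diff comb_cobd by simp
      qed
      moreover have "cobd (\<lambda>H. y' H k) G = z G k" if "G \<subseteq> W" for G k
        using cobd_y[OF that] cobd_cobd[OF fin[OF that], of "\<lambda>H. x' H k"]
        by (simp add: y'_def cobd_diff)
      ultimately show "\<exists>y. (\<forall>G\<subseteq>W. y G \<in> M (Suc i) G) \<and> (\<forall>G\<subseteq>W. \<forall>k. cobd (\<lambda>H. y H k) G = z G k)"
        by blast
    qed
  next
    assume ex: "koszul_exact (M (Suc i)) W (Suc s)"
    show "koszul_exact (M i) W s"
      unfolding koszul_exact_def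
    proof (intro allI impI)
      fix z assume "\<forall>G\<subseteq>W. z G \<in> M i G" and z0: "\<forall>G\<subseteq>W. card G \<noteq> s \<longrightarrow> z G = (\<lambda>_. 0)"
        and cocycle: "\<forall>G\<subseteq>W. \<forall>k. cobd (\<lambda>H. z H k) G = 0"
      then have z: "z G \<in> M i G" if "G \<subseteq> W" for G using that by blast
      obtain z' where L: "\<forall>G. (G \<subseteq> W \<longrightarrow> z' G \<in> ?F G \<and> ?c (z' G) = z G) \<and>
          (z G = (\<lambda>_. 0) \<longrightarrow> z' G = (\<lambda>_. 0))"
        using lift_cochain[OF W z] by (rule exE)
      have z': "z' G \<in> ?F G" "?c (z' G) = z G" if "G \<subseteq> W" for G
        using L that by simp_all
      have z'_0: "z' G = (\<lambda>_. 0)" if "z G = (\<lambda>_. 0)" for G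
        using L that by simp
      have dz': "(\<lambda>k. cobd (\<lambda>H. z' H k) G) \<in> M (Suc i) G" if "G \<subseteq> W" for G
      proof (rule free_M)
        show "(\<lambda>k. cobd (\<lambda>H. z' H k) G) \<in> ?F G"
          unfolding cobd_def
        proof (rule coord_subspace_sum[OF coord_subspace_free_system])
          show "z' (G - {u}) \<in> ?F G" for u
            using z'(1)[of "G - {u}"] that by (auto simp: free_system_def)
        qed
        have "cobd (\<lambda>H. ?c (z' H) m) G = cobd (\<lambda>H. z H m) G" for m
          by (rule cobd_cong) (use z'(2) that in auto)
        then show "?c (\<lambda>k. cobd (\<lambda>H. z' H k) G) m = 0" for m
          using cocycle that by (simp add: comb_cobd)
      qed
      obtain y where y: "\<And>G. G \<subseteq> W \<Longrightarrow> y G \<in> M (Suc i) G"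
        "\<And>G k. G \<subseteq> W \<Longrightarrow> cobd (\<lambda>H. y H k) G = cobd (\<lambda>H. z' H k) G"
      proof (rule koszul_exactD[OF ex, of "\<lambda>G k. cobd (\<lambda>H. z' H k) G"])
        show "(\<lambda>k. cobd (\<lambda>H. z' H k) G) = (\<lambda>_. 0)" if "G \<subseteq> W" "card G \<noteq> Suc s" for G
        proof
          fix k
          have "cobd (\<lambda>H. z' H k) G = cobd (\<lambda>H. 0) G"
            unfolding cobd_def
          proof (intro sum.cong refl arg_cong2[where f = "(*)"])
            fix u assume "u \<in> G"
            then have "Suc (card (G - {u})) = card G" using fin[OF that(1)] by (metis card_Suc_Diff1)
            then have "card (G - {u}) \<noteq> s" using that(2) by simp
            then have "z (G - {u}) = (\<lambda>_. 0)" using z0 that(1) by blast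
            then show "z' (G - {u}) k = 0" using z'_0 by simp
          qed
          then show "cobd (\<lambda>H. z' H k) G = 0" by simp
        qed
        show "cobd (\<lambda>H. cobd (\<lambda>H. z' H k) H) G = 0" if "G \<subseteq> W" for G k
          using cobd_cobd[OF fin[OF that]] .
        show "(\<lambda>k. cobd (\<lambda>H. z' H k) G) \<in> M (Suc i) G" if "G \<subseteq> W" for G using dz'[OF that] .
      qed blast
      obtain x where x: "\<And>G. G \<subseteq> W \<Longrightarrow> x G \<in> ?F G"
        "\<And>G k. G \<subseteq> W \<Longrightarrow> cobd (\<lambda>H. x H k) G = z' G k - y G k"
      proof (rule free_system_contraction[OF finW, of "\<lambda>G k. z' G k - y G k" "r i" "A i"])
        show "(\<lambda>k. z' G k - y G k) \<in> ?F G" if "G \<subseteq> W" for G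
          using coord_subspace_diff[OF coord_subspace_free_system z'(1)[OF that] M_free(1)[OF y(1)[OF that]]] .
        show "cobd (\<lambda>H. z' H k - y H k) G = 0" if "G \<subseteq> W" for G k
          using y(2)[OF that] by (simp add: cobd_diff)
        show "z' W k - y W k = 0" if "A i k = W" for k
        proof -
          have "z W = (\<lambda>_. 0)" using z0 s by simp
          then show ?thesis using z'_0 syzygy_eq_0[OF W y(1)[of W] that] by simp
        qed
      qed blast
      have "?c (x G) \<in> M i G" if "G \<subseteq> W" for G using comb_mem[OF sub1 x(1)] that by blast
      moreover have "cobd (\<lambda>H. ?c (x H) m) G = z G m" if "G \<subseteq> W" for G m
      proof -
        have "cobd (\<lambda>H. ?c (x H) m) G = ?c (\<lambda>k. z' G k - y G k) m"
          using x(2)[OF that] by (simp flip: comb_cobd)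
        then show ?thesis
          unfolding comb_diff using z'(2)[OF that] M_free(2)[OF y(1)[OF that]] by simp
      qed
      ultimately show "\<exists>y. (\<forall>G\<subseteq>W. y G \<in> M i G) \<and> (\<forall>G\<subseteq>W. \<forall>k. cobd (\<lambda>H. y H k) G = z G k)"
        by (intro exI[of _ "\<lambda>G. ?c (x G)"]) simp
    qed
  }
qed

text \<open>At the top size, cohomology is \<open>M i W\<close> modulo the sum of the smaller \<open>M i
  G\<close>, whose dimension is the number of generators of degree \<open>W\<close>.\<close>

lemma generator_iff_not_exact_top:
  assumes W: "W \<subseteq> {1..n}"
  shows "(\<exists>k<r i. A i k = W) \<longleftrightarrow> \<not> koszul_exact (M i) W (card W)"
proof
  let ?F = "free_system (r i) (A i)" and ?c = "comb (r i) (g i)"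
  have finW: "finite W" using W finite_subset by blast
  have fin: "finite G" if "G \<subseteq> W" for G using finW that finite_subset by blast
  have top: "G = W" if "G \<subseteq> W" "card G = card W" for G
    using that finW by (simp add: card_subset_eq)
  have cobd_top: "cobd (\<lambda>H. z H) G = 0"
    if "G \<subseteq> W" and z: "\<And>G. G \<subseteq> W \<Longrightarrow> card G \<noteq> card W \<Longrightarrow> z G = 0" for z :: "nat set \<Rightarrow> 'k" and G
  proof -
    have "z (G - {u}) = 0" if "u \<in> G" for u
    proof (rule z)
      have "card (G - {u}) < card G" using \<open>u \<in> G\<close> fin[OF \<open>G \<subseteq> W\<close>] by (metis card_Diff1_less)
      also have "\<dots> \<le> card W" using \<open>G \<subseteq> W\<close> finW by (rule card_mono[rotated])
      finally show "card (G - {u}) \<noteq> card W" by simp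
    qed (use \<open>G \<subseteq> W\<close> in auto)
    then show ?thesis by (simp add: cobd_def)
  qed
  {
    assume "\<exists>k<r i. A i k = W"
    then obtain k where k: "k < r i" "A i k = W" by blast
    show "\<not> koszul_exact (M i) W (card W)"
    proof
      assume ex: "koszul_exact (M i) W (card W)"
      define z where "z G = (if G = W then g i k else (\<lambda>_. 0))" for G
      obtain y where y: "\<And>G. G \<subseteq> W \<Longrightarrow> y G \<in> M i G" "\<And>G k. G \<subseteq> W \<Longrightarrow> cobd (\<lambda>H. y H k) G = z G k"
      proof (rule koszul_exactD[OF ex, of z])
        show "z G \<in> M i G" if "G \<subseteq> W" for G
          using that W g_mem[OF k(1)] k(2) coord_subspace_0[OF M_coord_subspace[of G i]] by (auto simp: z_def)
        show "z G = (\<lambda>_. 0)" if "card G \<noteq> card W" for G using that by (auto simp: z_def)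
        show "cobd (\<lambda>H. z H k) G = 0" if "G \<subseteq> W" for G k
          by (rule cobd_top[OF that]) (auto simp: z_def)
      qed blast
      obtain y' where "\<forall>G. (G \<subseteq> W \<longrightarrow> y' G \<in> ?F G \<and> ?c (y' G) = y G) \<and>
          (y G = (\<lambda>_. 0) \<longrightarrow> y' G = (\<lambda>_. 0))"
        using lift_cochain[OF W y(1)] by (rule exE)
      then have y': "y' G \<in> ?F G" "?c (y' G) = y G" if "G \<subseteq> W" for G
        using that by simp_all
      define f where "f j = (if j = k then 1 else 0) - cobd (\<lambda>H. y' H j) W" for j
      have zero: "cobd (\<lambda>H. y' H j) W = 0" if "A i j = W" for j
      proof -
        have "y' (W - {u}) j = 0" if "u \<in> W" for u
          using y'(1)[of "W - {u}"] that \<open>A i j = W\<close> by (auto simp: free_system_def)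
        then show ?thesis by (simp add: cobd_def)
      qed
      have "f \<in> M (Suc i) W"
        unfolding M_Suc syzygies_def
      proof (intro CollectI conjI allI)
        have "(\<lambda>j. cobd (\<lambda>H. y' H j) W) \<in> ?F W"
          unfolding cobd_def
        proof (rule coord_subspace_sum[OF coord_subspace_free_system])
          show "y' (W - {u}) \<in> ?F W" for u
            using y'(1)[of "W - {u}"] by (auto simp: free_system_def)
        qed
        moreover have "(\<lambda>j. if j = k then 1 else 0) \<in> ?F W" using k by (auto simp: free_system_def)
        ultimately show "f \<in> ?F W"
          unfolding f_def by (intro coord_subspace_diff coord_subspace_free_system)
        have "?c (\<lambda>j. if j = k then 1 else 0) m = g i k m" for m
          using k(1) by (simp add: comb_def if_distrib[of "\<lambda>x. x * _"] cong: if_cong)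
        moreover have "cobd (\<lambda>H. ?c (y' H) m) W = cobd (\<lambda>H. y H m) W" for m
          by (rule cobd_cong) (use y'(2) in auto)
        ultimately show "?c f m = 0" for m
          unfolding f_def comb_diff comb_cobd using y(2)[of W] by (simp add: z_def)
      qed
      then have "f k = 0" using syzygy_eq_0[OF W] k(2) by blast
      then show False using zero[OF k(2)] by (simp add: f_def)
    qed
  next
    assume nex: "\<not> koszul_exact (M i) W (card W)"
    show "\<exists>k<r i. A i k = W"
    proof (rule ccontr)
      assume no: "\<not> ?thesis"
      have "koszul_exact (M i) W (card W)"
        unfolding koszul_exact_def
      proof (intro allI impI)
        fix z assume "\<forall>G\<subseteq>W. z G \<in> M i G" and z0: "\<forall>G\<subseteq>W. card G \<noteq> card W \<longrightarrow> z G = (\<lambda>_. 0)"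
          and cocycle: "\<forall>G\<subseteq>W. \<forall>k. cobd (\<lambda>H. z H k) G = 0"
        then have z: "z G \<in> M i G" if "G \<subseteq> W" for G using that by blast
        obtain z' where L: "\<forall>G. (G \<subseteq> W \<longrightarrow> z' G \<in> ?F G \<and> ?c (z' G) = z G) \<and>
            (z G = (\<lambda>_. 0) \<longrightarrow> z' G = (\<lambda>_. 0))"
          using lift_cochain[OF W z] by (rule exE)
        have z': "z' G \<in> ?F G" "?c (z' G) = z G" if "G \<subseteq> W" for G
          using L that by simp_all
        have z'_0: "z' G = (\<lambda>_. 0)" if "z G = (\<lambda>_. 0)" for G
          using L that by simp
        obtain x where x: "\<And>G. G \<subseteq> W \<Longrightarrow> x G \<in> ?F G"
          "\<And>G k. G \<subseteq> W \<Longrightarrow> cobd (\<lambda>H. x H k) G = z' G k"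
        proof (rule free_system_contraction[OF finW, of z' "r i" "A i"])
          show "cobd (\<lambda>H. z' H k) G = 0" if "G \<subseteq> W" for G k
            by (rule cobd_top[OF that]) (use z0 z'_0 in auto)
          show "z' W k = 0" if "A i k = W" for k
            using z'(1)[of W] no that by (auto simp: free_system_def)
        qed (use z'(1) in auto)
        have "?c (x G) \<in> M i G" if "G \<subseteq> W" for G using comb_mem[OF _ x(1)] that W by blast
        moreover have "cobd (\<lambda>H. ?c (x H) m) G = z G m" if "G \<subseteq> W" for G m
          using x(2)[OF that] z'(2)[OF that] by (simp flip: comb_cobd)
        ultimately show "\<exists>y. (\<forall>G\<subseteq>W. y G \<in> M i G) \<and> (\<forall>G\<subseteq>W. \<forall>k. cobd (\<lambda>H. y H k) G = z G k)"
          by (intro exI[of _ "\<lambda>G. ?c (x G)"]) simp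
      qed
      then show False using nex by blast
    qed
  }
qed

lemma koszul_exact_shift_top:
  assumes "W \<subseteq> {1..n}" "i \<le> card W"
  shows "koszul_exact (M i) W (card W) \<longleftrightarrow> koszul_exact (M 0) W (card W - i)"
proof -
  have "koszul_exact (M j) W (card W - i + j) \<longleftrightarrow> koszul_exact (M 0) W (card W - i)" if "j \<le> i" for j
    using that
  proof (induction j)
    case (Suc j)
    then show ?case using koszul_exact_shift[OF assms(1), of "card W - i + j" j] assms(2) by simp
  qed simp
  from this[of i] show ?thesis using assms(2) by simp
qed

text \<open>Hochster's formula, restricted to the question which Betti numbers vanish: shifting down from
  \<open>M i\<close> to \<open>M 0\<close> lowers the size by \<open>i\<close>.\<close>

theorem generator_iff_not_exact:
  assumes "W \<subseteq> {1..n}"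
  shows "(\<exists>k<r i. A i k = W) \<longleftrightarrow> i \<le> card W \<and> \<not> koszul_exact (M 0) W (card W - i)"
  using generator_iff_not_exact_top[OF assms] koszul_exact_shift_top[OF assms] le_card_A by blast

end

section \<open>Relative cochains of clutters and flips\<close>

definition nonface :: "nat set set \<Rightarrow> nat set \<Rightarrow> bool" where
  "nonface D G \<longleftrightarrow> (\<exists>F\<in>D. F \<subseteq> G)"

text \<open>The ideal generated by the squarefree monomials of \<open>D\<close>, as a nested system inside one
  coordinate.\<close>

definition ideal_system :: "nat set set \<Rightarrow> nat set \<Rightarrow> (nat \<Rightarrow> 'k::field) set" where
  "ideal_system D G = {f. \<forall>k. f k \<noteq> 0 \<longrightarrow> k = 0 \<and> nonface D G}"

lemma nested_ideal_system: "nested_system n 1 (ideal_system D :: nat set \<Rightarrow> (nat \<Rightarrow> 'k::field) set)"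
proof -
  have "coord_subspace (ideal_system D G :: (nat \<Rightarrow> 'k) set)" for G
  proof -
    have "(\<lambda>k. f k + h k) \<in> ideal_system D G"
      if f: "f \<in> ideal_system D G" and h: "h \<in> ideal_system D G" for f h :: "nat \<Rightarrow> 'k"
      unfolding ideal_system_def
    proof (intro CollectI allI impI)
      fix k assume "f k + h k \<noteq> 0"
      then have "f k \<noteq> 0 \<or> h k \<noteq> 0" by auto
      then show "k = 0 \<and> nonface D G" using f h by (auto simp: ideal_system_def)
    qed
    moreover have "(\<lambda>_. 0) \<in> ideal_system D G" by (simp add: ideal_system_def)
    moreover have "(\<lambda>k. c * f k) \<in> ideal_system D G"
      if "f \<in> ideal_system D G" for c :: 'k and f
      using that by (auto simp: ideal_system_def)
    ultimately show ?thesis unfolding coord_subspace_def by (intro conjI ballI allI)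
  qed
  moreover have "ideal_system D V \<subseteq> ideal_system D W" if "V \<subseteq> W" for V W
    using that by (auto simp: ideal_system_def nonface_def) (meson dual_order.trans)
  moreover have "f k = 0" if "f \<in> ideal_system D G" "k \<ge> 1" for f :: "nat \<Rightarrow> 'k" and k G
    using that by (auto simp: ideal_system_def)
  ultimately show ?thesis unfolding nested_system_def by blast
qed

text \<open>Exactness at size \<open>s\<close> of the cochains on \<open>W\<close> that vanish on faces. The
  type argument fixes the field of coefficients, which the other arguments do not determine.\<close>

definition relative_exact :: "'k::field itself \<Rightarrow> nat set set \<Rightarrow> nat set \<Rightarrow> nat \<Rightarrow> bool" where
  "relative_exact _ D W s \<longleftrightarrow>
     (\<forall>z :: nat set \<Rightarrow> 'k. (\<forall>G\<subseteq>W. z G \<noteq> 0 \<longrightarrow> card G = s \<and> nonface D G) \<longrightarrow>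
        (\<forall>G\<subseteq>W. cobd z G = 0) \<longrightarrow>
        (\<exists>y. (\<forall>G\<subseteq>W. y G \<noteq> 0 \<longrightarrow> Suc (card G) = s \<and> nonface D G) \<and> (\<forall>G\<subseteq>W. cobd y G = z G)))"

lemma koszul_exact_ideal_system:
  assumes "finite W"
  shows "koszul_exact (ideal_system D :: nat set \<Rightarrow> (nat \<Rightarrow> 'k::field) set) W s
    \<longleftrightarrow> relative_exact TYPE('k) D W s"
proof
  assume ex: "koszul_exact (ideal_system D :: nat set \<Rightarrow> (nat \<Rightarrow> 'k) set) W s"
  show "relative_exact TYPE('k) D W s"
    unfolding relative_exact_def
  proof (intro allI impI)
    fix z :: "nat set \<Rightarrow> 'k"
    assume z: "\<forall>G\<subseteq>W. z G \<noteq> 0 \<longrightarrow> card G = s \<and> nonface D G" and cocycle: "\<forall>G\<subseteq>W. cobd z G = 0"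
    obtain y where y: "\<And>G. G \<subseteq> W \<Longrightarrow> y G \<in> ideal_system D G"
      "\<And>G k. G \<subseteq> W \<Longrightarrow> cobd (\<lambda>H. y H k) G = (if k = 0 then z G else 0)"
    proof (rule koszul_exactD[OF ex, of "\<lambda>G k. if k = 0 then z G else 0"])
      show "cobd (\<lambda>H. if k = 0 then z H else 0) G = 0" if "G \<subseteq> W" for G k
        using cocycle that by (cases "k = 0") auto
      show "(\<lambda>k. if k = 0 then z G else 0) = (\<lambda>_. 0)" if "G \<subseteq> W" "card G \<noteq> s" for G
      proof -
        have "z G = 0" using z that by blast
        then show ?thesis by auto
      qed
    qed (use z in \<open>auto simp: ideal_system_def\<close>)
    let ?y = "\<lambda>G. if Suc (card G) = s then y G 0 else 0"
    have "cobd ?y G = z G" if "G \<subseteq> W" for G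
    proof -
      have "cobd ?y G = (if card G = s then z G else 0)"
        using cobd_truncate[OF finite_subset[OF that assms], of s "\<lambda>H. y H 0"] y(2)[OF that, of 0] by simp
      then show ?thesis using z that by auto
    qed
    moreover have "Suc (card G) = s \<and> nonface D G" if "G \<subseteq> W" "?y G \<noteq> 0" for G
      using y(1)[OF that(1)] that(2) by (auto simp: ideal_system_def split: if_splits)
    ultimately show "\<exists>y. (\<forall>G\<subseteq>W. y G \<noteq> 0 \<longrightarrow> Suc (card G) = s \<and> nonface D G) \<and> (\<forall>G\<subseteq>W. cobd y G = z G)"
      by (intro exI[of _ ?y]) blast
  qed
next
  assume ex: "relative_exact TYPE('k) D W s"
  show "koszul_exact (ideal_system D :: nat set \<Rightarrow> (nat \<Rightarrow> 'k) set) W s"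
    unfolding koszul_exact_def
  proof (intro allI impI)
    fix z :: "nat set \<Rightarrow> nat \<Rightarrow> 'k"
    assume z: "\<forall>G\<subseteq>W. z G \<in> ideal_system D G" and z0: "\<forall>G\<subseteq>W. card G \<noteq> s \<longrightarrow> z G = (\<lambda>_. 0)"
      and cocycle: "\<forall>G\<subseteq>W. \<forall>k. cobd (\<lambda>H. z H k) G = 0"
    have "\<exists>y. (\<forall>G\<subseteq>W. y G \<noteq> 0 \<longrightarrow> Suc (card G) = s \<and> nonface D G) \<and> (\<forall>G\<subseteq>W. cobd y G = z G 0)"
    proof (rule ex[unfolded relative_exact_def, rule_format])
      show "cobd (\<lambda>G. z G 0) G = 0" if "G \<subseteq> W" for G using cocycle that by blast
      show "card G = s \<and> nonface D G" if "G \<subseteq> W" "z G 0 \<noteq> 0" for G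
      proof -
        have "z G \<in> ideal_system D G" using z that(1) by blast
        moreover have "card G = s"
        proof (rule ccontr)
          assume "card G \<noteq> s"
          then have "z G = (\<lambda>_. 0)" using z0 that(1) by blast
          then show False using that(2) by simp
        qed
        ultimately show ?thesis using that(2) by (auto simp: ideal_system_def)
      qed
    qed
    then obtain y where y: "\<forall>G\<subseteq>W. y G \<noteq> 0 \<longrightarrow> Suc (card G) = s \<and> nonface D G"
      "\<forall>G\<subseteq>W. cobd y G = z G 0" by blast
    let ?y = "\<lambda>G k. if k = (0::nat) then y G else 0"
    have "cobd (\<lambda>H. ?y H k) G = z G k" if "G \<subseteq> W" for G k
    proof (cases "k = 0")
      case False
      have "z G \<in> ideal_system D G" using z that by blast
      then show ?thesis using False by (auto simp: ideal_system_def)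
    qed (use y(2) that in auto)
    moreover have "?y G \<in> ideal_system D G" if "G \<subseteq> W" for G
      using y(1) that by (auto simp: ideal_system_def)
    ultimately show "\<exists>y. (\<forall>G\<subseteq>W. y G \<in> ideal_system D G) \<and> (\<forall>G\<subseteq>W. \<forall>k. cobd (\<lambda>H. y H k) G = z G k)"
      by (intro exI[of _ ?y]) simp
  qed
qed

lemma card_triples: "F \<in> triples n \<Longrightarrow> card F = 3"
  by (simp add: triples_def)

lemma nonface_card:
  assumes "D \<subseteq> triples n" "finite G" "nonface D G"
  shows "3 \<le> card G"
proof -
  obtain F where "F \<in> D" "F \<subseteq> G" using assms(3) by (auto simp: nonface_def)
  then show ?thesis using card_triples[of F n] card_mono[OF assms(2), of F] assms(1) by auto
qed

lemma relative_exact_below_3: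
  assumes D: "D \<subseteq> triples n" and W: "finite W" and s: "s < 3"
  shows "relative_exact TYPE('k::field) D W s"
  unfolding relative_exact_def
proof (intro allI impI)
  fix z :: "nat set \<Rightarrow> 'k"
  assume "\<forall>G\<subseteq>W. z G \<noteq> 0 \<longrightarrow> card G = s \<and> nonface D G"
  then have "z G = 0" if "G \<subseteq> W" for G
    using nonface_card[OF D finite_subset[OF that W]] s that by (metis leD)
  then show "\<exists>y. (\<forall>G\<subseteq>W. y G \<noteq> 0 \<longrightarrow> Suc (card G) = s \<and> nonface D G) \<and> (\<forall>G\<subseteq>W. cobd y G = z G)"
    by (intro exI[of _ "\<lambda>_. 0"]) simp
qed

text \<open>No proper subset of \<open>F\<close> is a nonface, so the indicator of \<open>F\<close> is a
  cocycle without a primitive.\<close>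

lemma not_relative_exact_3:
  assumes D: "D \<subseteq> triples n" and F: "F \<in> D"
  shows "\<not> relative_exact TYPE('k::field) D F 3"
proof
  assume ex: "relative_exact TYPE('k) D F 3"
  have card: "card F = 3" using D F card_triples by blast
  then have fin: "finite F" by (metis card.infinite zero_neq_numeral)
  let ?z = "\<lambda>G. if G = F then 1 else 0 :: 'k"
  have "\<exists>y. (\<forall>G\<subseteq>F. y G \<noteq> 0 \<longrightarrow> Suc (card G) = 3 \<and> nonface D G) \<and> (\<forall>G\<subseteq>F. cobd y G = ?z G)"
  proof (rule ex[unfolded relative_exact_def, rule_format])
    show "cobd ?z G = 0" if "G \<subseteq> F" for G
      using that unfolding cobd_def by (intro sum.neutral) auto
  qed (use F card in \<open>auto simp: nonface_def split: if_splits\<close>)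
  then obtain y where y: "\<forall>G\<subseteq>F. y G \<noteq> 0 \<longrightarrow> Suc (card G) = 3 \<and> nonface D G" "\<forall>G\<subseteq>F. cobd y G = ?z G"
    by blast
  have "y G = 0" if "G \<subseteq> F" for G
  proof (rule ccontr)
    assume "y G \<noteq> 0"
    then have "Suc (card G) = 3 \<and> nonface D G" using y(1) that by blast
    then show False using nonface_card[OF D finite_subset[OF that fin]] by simp
  qed
  then have "cobd y F = 0" unfolding cobd_def by (intro sum.neutral) auto
  then show False using y(2) by simp
qed

text \<open>The flip with the roles of \<open>{p, q}\<close> and \<open>{s, t}\<close> exchanged undoes the
  flip; so one direction of each comparison suffices.\<close>

lemma flip_symmetric:
  assumes C: "uniform3_clutter n C" and flip: "is_flip C C'"
  shows "uniform3_clutter n C'" "is_flip C' C"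
proof -
  obtain p q s t where d: "distinct [p, q, s, t]"
    and pq: "{F \<in> C. {p, q} \<subseteq> F} = {{p, q, s}, {p, q, t}}"
    and st: "\<forall>F\<in>C. \<not> {s, t} \<subseteq> F"
    and C': "C' = (C \<union> {{p, s, t}, {q, s, t}}) - {{p, q, s}, {p, q, t}}"
    using flip unfolding is_flip_def by blast
  have in_C: "{p, q, s} \<in> C" "{p, q, t} \<in> C" using pq by blast+
  then have "{p, q, s} \<subseteq> {1..n}" "{p, q, t} \<subseteq> {1..n}"
    using C by (auto simp: uniform3_clutter_def triples_def)
  then have "{p, s, t} \<in> triples n" "{q, s, t} \<in> triples n"
    using d by (simp_all add: triples_def)
  then show "uniform3_clutter n C'"
    using C unfolding C' uniform3_clutter_def by blast
  define X Y U V where "X = {p, q, s}" "Y = {p, q, t}" "U = {p, s, t}" "V = {q, s, t}"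
  note XYUV = this
  have sub: "{s, t} \<subseteq> U" "{s, t} \<subseteq> V" "\<not> {p, q} \<subseteq> U" "\<not> {p, q} \<subseteq> V"
    "\<not> {s, t} \<subseteq> X" "\<not> {s, t} \<subseteq> Y"
    using d by (auto simp: XYUV)
  then have ne: "U \<noteq> X" "U \<noteq> Y" "V \<noteq> X" "V \<noteq> Y" by blast+
  have C'_eq: "C' = (C \<union> {U, V}) - {X, Y}" by (simp add: C' XYUV)
  have "{F \<in> C'. {s, t} \<subseteq> F} = {U, V}"
  proof (rule Set.set_eqI)
    fix F
    have "F \<in> {U, V}" if "F \<in> C'" "{s, t} \<subseteq> F"
      using that st unfolding C'_eq by (metis DiffD1 UnE)
    moreover have "U \<in> C'" "V \<in> C'" using ne by (simp_all add: C'_eq)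
    ultimately show "F \<in> {F \<in> C'. {s, t} \<subseteq> F} \<longleftrightarrow> F \<in> {U, V}"
      using sub by (metis (mono_tags, lifting) insertE mem_Collect_eq singletonD)
  qed
  moreover have "\<forall>F\<in>C'. \<not> {p, q} \<subseteq> F"
  proof
    fix F assume "F \<in> C'"
    moreover have "F \<in> {X, Y}" if "F \<in> C" "{p, q} \<subseteq> F"
    proof -
      have "F \<in> {F \<in> C. {p, q} \<subseteq> F}" using that by blast
      then show ?thesis unfolding pq XYUV .
    qed
    ultimately show "\<not> {p, q} \<subseteq> F" using sub unfolding C'_eq by blast
  qed
  moreover have "C = (C' \<union> {X, Y}) - {U, V}"
  proof -
    have "X \<in> C" "Y \<in> C" using in_C by (simp_all add: XYUV)
    moreover have "U \<notin> C" "V \<notin> C" using st sub by blast+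
    ultimately show ?thesis using ne unfolding C'_eq by blast
  qed
  moreover have "X = {s, p, q}" "Y = {t, p, q}" "U = {s, t, p}" "V = {s, t, q}"
    unfolding XYUV by blast+
  ultimately have "distinct [s, t, p, q] \<and> {F \<in> C'. {s, t} \<subseteq> F} = {{s, t, p}, {s, t, q}} \<and>
      (\<forall>F\<in>C'. \<not> {p, q} \<subseteq> F) \<and> C = (C' \<union> {{s, p, q}, {t, p, q}}) - {{s, t, p}, {s, t, q}}"
    using d by simp
  then show "is_flip C' C" unfolding is_flip_def by blast
qed

text \<open>Before the flip, a face \<open>G\<close> with at least four elements does not contain \<open>{s,
  t}\<close>, which lies in no circuit. It does not contain \<open>{p, q}\<close> either, since then
  it would be \<open>{p, q, s, t}\<close>. So none of the exchanged triples lies in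
  \<open>G\<close>.\<close>

lemma nonface_flip_mono:
  assumes C: "uniform3_clutter n C" and flip: "is_flip C C'"
    and G: "G \<subseteq> {1..n}" "4 \<le> card G" and nf: "nonface (clutter_complement n C') G"
  shows "nonface (clutter_complement n C) G"
proof (rule ccontr)
  assume face: "\<not> ?thesis"
  obtain p q s t where d: "distinct [p, q, s, t]"
    and pq: "{F \<in> C. {p, q} \<subseteq> F} = {{p, q, s}, {p, q, t}}"
    and st: "\<forall>F\<in>C. \<not> {s, t} \<subseteq> F"
    and C': "C' = (C \<union> {{p, s, t}, {q, s, t}}) - {{p, q, s}, {p, q, t}}"
    using flip unfolding is_flip_def by blast
  have in_C: "F \<in> C" if "F \<subseteq> G" "card F = 3" for F
    using face that G(1) by (auto simp: nonface_def clutter_complement_def triples_def)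
  have "\<exists>u v. u \<in> G \<and> v \<in> G \<and> u \<noteq> v \<and> u \<notin> {a, b} \<and> v \<notin> {a, b}" if "a \<noteq> b" for a b
  proof -
    have fin: "finite G" using G(1) finite_subset by blast
    have "card {a, b} = 2" using that by simp
    then have "2 \<le> card (G - {a, b})"
      using G(2) diff_card_le_card_Diff[of "{a, b}" G] by simp
    then obtain B where "B \<subseteq> G - {a, b}" "card B = 2" by (metis obtain_subset_with_card_n)
    then show ?thesis by (metis DiffE card_2_iff insert_subset)
  qed note two = this
  have "\<not> {s, t} \<subseteq> G"
  proof
    assume sub: "{s, t} \<subseteq> G"
    obtain u where "u \<in> G" "u \<notin> {s, t}" using two[of s t] d by auto
    then have "{u, s, t} \<in> C" using sub d by (intro in_C) auto
    then show False using st by blast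
  qed
  moreover have "\<not> {p, q} \<subseteq> G"
  proof
    assume sub: "{p, q} \<subseteq> G"
    obtain u v where uv: "u \<in> G" "v \<in> G" "u \<noteq> v" "u \<notin> {p, q}" "v \<notin> {p, q}" using two[of p q] d by auto
    have mem: "{p, q, w} \<in> C" if "w \<in> G" "w \<notin> {p, q}" for w
      using sub d that by (intro in_C) auto
    have "w = s \<or> w = t" if "w \<in> G" "w \<notin> {p, q}" for w
    proof -
      have "{p, q, w} \<in> {F \<in> C. {p, q} \<subseteq> F}" using mem[OF that] by blast
      then have "{p, q, w} = {p, q, s} \<or> {p, q, w} = {p, q, t}"
        unfolding pq by (simp only: insert_iff empty_iff simp_thms)
      then have "w \<in> {p, q, s} \<or> w \<in> {p, q, t}" by (metis insertCI)
      then show ?thesis using that by simp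
    qed
    then have "s \<in> G \<and> t \<in> G" using uv by metis
    then have "{p, s, t} \<in> C" using sub d by (intro in_C) auto
    then show False using st by blast
  qed
  moreover obtain F where F: "F \<subseteq> G" "F \<in> triples n" "F \<notin> C'"
    using nf by (auto simp: nonface_def clutter_complement_def)
  ultimately show False using in_C[OF F(1) card_triples[OF F(2)]] F(1,3) unfolding C' by auto
qed

lemma nonface_flip_iff:
  assumes C: "uniform3_clutter n C" and flip: "is_flip C C'" and G: "G \<subseteq> {1..n}" "4 \<le> card G"
  shows "nonface (clutter_complement n C') G \<longleftrightarrow> nonface (clutter_complement n C) G"
  using nonface_flip_mono[OF C flip G] nonface_flip_mono[OF flip_symmetric[OF C flip] G] by blast

lemma cobd_indicator:
  assumes "finite G" "v \<in> G"
  shows "cobd (\<lambda>H. if H = G - {v} then 1 else 0) G = pos_sign v G"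
proof -
  have "cobd (\<lambda>H. if H = G - {v} then 1 else 0) G = (\<Sum>u\<in>G. if u = v then pos_sign v G else 0 :: 'a)"
    unfolding cobd_def by (rule sum.cong) (use assms in auto)
  then show ?thesis using assms by simp
qed

lemma cobd_indicator_nonzero:
  assumes "cobd (\<lambda>H. if H = X then 1 else 0) G \<noteq> (0::'k::field)"
  obtains u where "u \<notin> X" "G = insert u X"
proof -
  have "\<exists>u\<in>G. G - {u} = X"
  proof (rule ccontr)
    assume "\<not> ?thesis"
    then have "cobd (\<lambda>H. if H = X then 1 else 0) G = (0::'k)"
      unfolding cobd_def by (intro sum.neutral) auto
    then show False using assms by simp
  qed
  then show ?thesis using that by blast
qed

text \<open>Only size \<open>4\<close> needs an argument. A cocycle after the flip is first changed by a
  multiple of the coboundary of the indicator of \<open>{p, q, s}\<close>, a nonface after the flip,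
  so that it vanishes at \<open>{p, q, s, t}\<close>. It is also a cocycle before the flip and so
  has a primitive \<open>y\<close>. All triples over \<open>{s, t}\<close> are nonfaces before the
  flip, hence \<open>y\<close> may be changed by the coboundary of the indicator of \<open>{s,
  t}\<close>, which removes the value at \<open>{p, s, t}\<close>. The value at \<open>{q, s,
  t}\<close> is then forced to be zero by the vanishing at \<open>{p, q, s, t}\<close>. If
  \<open>p\<close> is not in \<open>W\<close>, the value at \<open>{q, s, t}\<close> is removed
  directly.\<close>

lemma relative_exact_flip:
  assumes C: "uniform3_clutter n C" and flip: "is_flip C C'" and W: "W \<subseteq> {1..n}" and m: "4 \<le> m"
    and ex: "relative_exact TYPE('k::field) (clutter_complement n C) W m"
  shows "relative_exact TYPE('k) (clutter_complement n C') W m"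
  unfolding relative_exact_def
proof (intro allI impI)
  let ?D = "clutter_complement n C" and ?D' = "clutter_complement n C'"
  fix z :: "nat set \<Rightarrow> 'k"
  assume z: "\<forall>G\<subseteq>W. z G \<noteq> 0 \<longrightarrow> card G = m \<and> nonface ?D' G" and cocycle: "\<forall>G\<subseteq>W. cobd z G = 0"
  have finW: "finite W" using W finite_subset by blast
  have fin: "finite G" if "G \<subseteq> W" for G using finW that finite_subset by blast
  have iff: "nonface ?D' G \<longleftrightarrow> nonface ?D G" if "G \<subseteq> W" "4 \<le> card G" for G
    using nonface_flip_iff[OF C flip] that W by blast
  show "\<exists>y. (\<forall>G\<subseteq>W. y G \<noteq> 0 \<longrightarrow> Suc (card G) = m \<and> nonface ?D' G) \<and> (\<forall>G\<subseteq>W. cobd y G = z G)"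
  proof (cases "m = 4")
    case False
    have "\<exists>y. (\<forall>G\<subseteq>W. y G \<noteq> 0 \<longrightarrow> Suc (card G) = m \<and> nonface ?D G) \<and> (\<forall>G\<subseteq>W. cobd y G = z G)"
    proof (rule ex[unfolded relative_exact_def, rule_format])
      show "card G = m \<and> nonface ?D G" if "G \<subseteq> W" "z G \<noteq> 0" for G
        using z iff that m by blast
    qed (use cocycle in auto)
    then obtain y where y: "\<forall>G\<subseteq>W. y G \<noteq> 0 \<longrightarrow> Suc (card G) = m \<and> nonface ?D G" "\<forall>G\<subseteq>W. cobd y G = z G"
      by blast
    have "Suc (card G) = m \<and> nonface ?D' G" if "G \<subseteq> W" "y G \<noteq> 0" for G
    proof -
      have "Suc (card G) = m \<and> nonface ?D G" using y(1) that by blast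
      then show ?thesis using iff[OF that(1)] m False by simp
    qed
    then show ?thesis using y(2) by blast
  next
    case True
    obtain p q s t where d: "distinct [p, q, s, t]"
      and pq: "{F \<in> C. {p, q} \<subseteq> F} = {{p, q, s}, {p, q, t}}"
      and st: "\<forall>F\<in>C. \<not> {s, t} \<subseteq> F"
      and C': "C' = (C \<union> {{p, s, t}, {q, s, t}}) - {{p, q, s}, {p, q, t}}"
      using flip unfolding is_flip_def by blast
    let ?Q = "{p, q, s, t}"
    define e where "e X = (\<lambda>H. if H = X then 1 else 0 :: 'k)" for X :: "nat set"
    have cobd_e: "cobd (e X) G = pos_sign v G" if "finite G" "v \<in> G" "X = G - {v}" for X G v
      using cobd_indicator[OF that(1,2)] that(3) by (simp add: e_def)
    have cobd_e_0: "\<exists>u. u \<notin> X \<and> G = insert u X" if "cobd (e X) G \<noteq> 0" for X G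
      using that cobd_indicator_nonzero unfolding e_def by blast
    have in_C: "{p, q, s} \<in> C" "{p, q, t} \<in> C" using pq by blast+
    have pqs: "{p, q, s} \<in> ?D'"
      using in_C C by (auto simp: C' uniform3_clutter_def clutter_complement_def)
    \<comment> \<open>first make the value at \<open>?Q\<close> vanish\<close>
    define c1 where "c1 = (if ?Q \<subseteq> W then z ?Q / pos_sign t ?Q else 0)"
    define z' where "z' G = z G - c1 * cobd (e {p, q, s}) G" for G
    have z'_Q: "z' ?Q = 0" if "?Q \<subseteq> W"
    proof -
      have "cobd (e {p, q, s}) ?Q = pos_sign t ?Q" by (rule cobd_e) (use d in auto)
      then show ?thesis using that by (simp add: z'_def c1_def)
    qed
    have "\<exists>y. (\<forall>G\<subseteq>W. y G \<noteq> 0 \<longrightarrow> Suc (card G) = m \<and> nonface ?D G) \<and> (\<forall>G\<subseteq>W. cobd y G = z' G)"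
    proof (rule ex[unfolded relative_exact_def, rule_format])
      show "card G = m \<and> nonface ?D G" if G: "G \<subseteq> W" "z' G \<noteq> 0" for G
      proof (cases "z G = 0")
        case True
        then have "cobd (e {p, q, s}) G \<noteq> 0" using G(2) by (auto simp: z'_def)
        from cobd_e_0[OF this] obtain u where u: "u \<notin> {p, q, s}" "G = insert u {p, q, s}" by (elim exE conjE)
        then have "card G = m" using d \<open>m = 4\<close> by auto
        moreover have "nonface ?D' G" using pqs u(2) by (auto simp: nonface_def)
        ultimately show ?thesis using iff[OF G(1)] m by simp
      next
        case False
        then show ?thesis using z iff[OF G(1)] G(1) m by simp
      qed
      show "cobd z' G = 0" if "G \<subseteq> W" for G
        using cocycle cobd_cobd[OF fin[OF that], of "e {p, q, s}"] that
        by (simp add: z'_def[abs_def] cobd_diff cobd_scale)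
    qed
    then obtain y where y: "\<forall>G\<subseteq>W. y G \<noteq> 0 \<longrightarrow> Suc (card G) = m \<and> nonface ?D G"
      "\<forall>G\<subseteq>W. cobd y G = z' G" by blast
    have y_D: "G \<in> ?D" if "G \<subseteq> W" "y G \<noteq> 0" for G
    proof -
      have "card G = 3" using y(1) that \<open>m = 4\<close> by auto
      moreover have "nonface ?D G" using y(1) that by blast
      then obtain F where F: "F \<in> ?D" "F \<subseteq> G" by (auto simp: nonface_def)
      moreover have "card F = 3" using F(1) card_triples by (auto simp: clutter_complement_def)
      ultimately have "F = G" using fin[OF that(1)] by (intro card_subset_eq) auto
      then show ?thesis using F by simp
    qed
    \<comment> \<open>then move the values at \<open>{p, s, t}\<close> and \<open>{q, s, t}\<close> to the other triples over \<open>{s, t}\<close>\<close>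
    define c2 where "c2 = (if p \<in> W then y {p, s, t} / pos_sign p {p, s, t}
                           else y {q, s, t} / pos_sign q {q, s, t})"
    define y2 where "y2 G = y G - c2 * cobd (e {s, t}) G" for G
    have cobd_y2: "cobd y2 G = z' G" if "G \<subseteq> W" for G
      using y(2) cobd_cobd[OF fin[OF that], of "e {s, t}"] that
      by (simp add: y2_def[abs_def] cobd_diff cobd_scale)
    have y2_D: "G \<in> ?D" if "G \<subseteq> W" "y2 G \<noteq> 0" for G
    proof (cases "y G = 0")
      case True
      then have "cobd (e {s, t}) G \<noteq> 0" using that(2) by (auto simp: y2_def)
      from cobd_e_0[OF this] obtain u where u: "u \<notin> {s, t}" "G = insert u {s, t}" by (elim exE conjE)
      have "card G = 3" "G \<subseteq> {1..n}" using u d that(1) W by (simp, blast)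
      then have "G \<in> triples n" by (simp add: triples_def)
      moreover have "G \<notin> C" using st u(2) by blast
      ultimately show ?thesis by (simp add: clutter_complement_def)
    qed (use y_D that in auto)
    have "cobd (e {s, t}) {p, s, t} = pos_sign p {p, s, t}" "cobd (e {s, t}) {q, s, t} = pos_sign q {q, s, t}"
      by (rule cobd_e; use d in auto)+
    then have y2_st: "p \<in> W \<Longrightarrow> y2 {p, s, t} = 0" "p \<notin> W \<Longrightarrow> y2 {q, s, t} = 0"
      by (simp_all add: y2_def c2_def)
    have y2_D': "G \<in> ?D'" if G: "G \<subseteq> W" "y2 G \<noteq> 0" for G
    proof -
      have "G \<noteq> {p, s, t}" using G y2_st(1) by auto
      moreover have "G \<noteq> {q, s, t}"
      proof
        assume Gq: "G = {q, s, t}"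
        then have "p \<in> W" using y2_st(2) G(2) by blast
        then have QW: "?Q \<subseteq> W" using Gq G(1) by auto
        have "y2 {p, q, s} = 0" "y2 {p, q, t} = 0"
          using y2_D[of "{p, q, s}"] y2_D[of "{p, q, t}"] QW in_C by (auto simp: clutter_complement_def)
        moreover have "?Q - {q} = {p, s, t}" "?Q - {s} = {p, q, t}" "?Q - {t} = {p, q, s}" "?Q - {p} = G"
          using d Gq by auto
        moreover have "cobd y2 ?Q = (\<Sum>u\<in>?Q. pos_sign u ?Q * y2 (?Q - {u}))" by (simp add: cobd_def)
        moreover have "\<dots> = pos_sign p ?Q * y2 (?Q - {p}) + (pos_sign q ?Q * y2 (?Q - {q})
            + (pos_sign s ?Q * y2 (?Q - {s}) + pos_sign t ?Q * y2 (?Q - {t})))"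
          using d by (subst sum.insert; simp)+
        ultimately have "cobd y2 ?Q = pos_sign p ?Q * y2 G" using y2_st(1)[OF \<open>p \<in> W\<close>] by simp
        then show False using cobd_y2[OF QW] z'_Q[OF QW] G(2) by simp
      qed
      ultimately show ?thesis using y2_D[OF G] by (auto simp: clutter_complement_def C')
    qed
    define y3 where "y3 G = y2 G + c1 * e {p, q, s} G" for G
    have "Suc (card G) = m \<and> nonface ?D' G" if G: "G \<subseteq> W" "y3 G \<noteq> 0" for G
    proof -
      have "G \<in> ?D'"
      proof (cases "y2 G = 0")
        case True
        then have "G = {p, q, s}" using G(2) by (auto simp: y3_def e_def split: if_splits)
        then show ?thesis using pqs by simp
      qed (use y2_D' G in auto)
      then show ?thesis
        using \<open>m = 4\<close> card_triples by (auto simp: nonface_def clutter_complement_def)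
    qed
    moreover have "cobd y3 G = z G" if "G \<subseteq> W" for G
      using cobd_y2[OF that] by (simp add: y3_def[abs_def] cobd_add cobd_scale z'_def)
    ultimately show ?thesis by (intro exI[of _ y3]) simp
  qed
qed

text \<open>By Hochster's formula these are the differences \<open>j - i\<close> over all nonzero Betti
  numbers in homological degree \<open>i\<close> and degree \<open>j\<close>; the bound \<open>s
  \<le> card W\<close> says that \<open>i = card W - s\<close> is not negative.\<close>

definition nonexact_degrees :: "'k::field itself \<Rightarrow> nat \<Rightarrow> nat set set \<Rightarrow> nat set" where
  "nonexact_degrees K n D = {s. \<exists>W\<subseteq>{1..n}. s \<le> card W \<and> \<not> relative_exact K D W s}"

lemma nonexact_degrees_flip_subset:
  assumes C: "uniform3_clutter n C" and flip: "is_flip C C'"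
  shows "nonexact_degrees TYPE('k::field) n (clutter_complement n C')
    \<subseteq> nonexact_degrees TYPE('k) n (clutter_complement n C)"
proof
  fix m assume "m \<in> nonexact_degrees TYPE('k) n (clutter_complement n C')"
  then obtain W where W: "W \<subseteq> {1..n}" "m \<le> card W"
    "\<not> relative_exact TYPE('k) (clutter_complement n C') W m"
    by (auto simp: nonexact_degrees_def)
  have triples: "clutter_complement n X \<subseteq> triples n" for X by (auto simp: clutter_complement_def)
  have "finite W" using W(1) finite_subset by blast
  then have "3 \<le> m" using relative_exact_below_3[OF triples] W(3) by (metis not_less)
  show "m \<in> nonexact_degrees TYPE('k) n (clutter_complement n C)"
  proof (cases "m = 3")
    case True
    obtain p q s t where d: "distinct [p, q, s, t]"
      and pq: "{F \<in> C. {p, q} \<subseteq> F} = {{p, q, s}, {p, q, t}}"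
      and st: "\<forall>F\<in>C. \<not> {s, t} \<subseteq> F"
      and C': "C' = (C \<union> {{p, s, t}, {q, s, t}}) - {{p, q, s}, {p, q, t}}"
      using flip unfolding is_flip_def by blast
    have "{p, q, s} \<in> C" "{p, q, t} \<in> C" using pq by blast+
    then have "{p, q, s} \<subseteq> {1..n}" "{p, q, t} \<subseteq> {1..n}"
      using C by (auto simp: uniform3_clutter_def triples_def)
    then have pst: "{p, s, t} \<in> triples n" using d by (simp add: triples_def)
    moreover have "{p, s, t} \<notin> C" using st by blast
    ultimately have "{p, s, t} \<in> clutter_complement n C" by (simp add: clutter_complement_def)
    then have "\<not> relative_exact TYPE('k) (clutter_complement n C) {p, s, t} m"
      using not_relative_exact_3[OF triples] True by blast
    moreover have "{p, s, t} \<subseteq> {1..n}" "m \<le> card {p, s, t}"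
      using pst True by (simp_all add: triples_def)
    ultimately show ?thesis unfolding nonexact_degrees_def by blast
  next
    case False
    then have "4 \<le> m" using \<open>3 \<le> m\<close> by simp
    then show ?thesis using relative_exact_flip[OF C flip W(1)] W by (auto simp: nonexact_degrees_def)
  qed
qed

theorem nonexact_degrees_flip:
  assumes "uniform3_clutter n C" "is_flip C C'"
  shows "nonexact_degrees TYPE('k::field) n (clutter_complement n C')
    = nonexact_degrees TYPE('k) n (clutter_complement n C)"
  using nonexact_degrees_flip_subset[OF assms] nonexact_degrees_flip_subset[OF flip_symmetric[OF assms]]
  by blast

section \<open>Monomial matrices and squarefree modules\<close>

abbreviation polys :: "nat \<Rightarrow> 'k::field mpoly set" where
  "polys n \<equiv> carrier (poly_ring n)"

lemma keys_add_nat: "Poly_Mapping.keys (a + b :: nat \<Rightarrow>\<^sub>0 nat) = Poly_Mapping.keys a \<union> Poly_Mapping.keys b"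
  by (auto simp: in_keys_iff lookup_add)

lemma poly_ring_sel [simp]:
  "p \<otimes>\<^bsub>poly_ring n\<^esub> q = p * q" "p \<oplus>\<^bsub>poly_ring n\<^esub> q = p + q"
  "\<one>\<^bsub>poly_ring n\<^esub> = 1" "\<zero>\<^bsub>poly_ring n\<^esub> = 0"
  by (simp_all add: poly_ring_def)

lemma polys_iff: "p \<in> polys n \<longleftrightarrow> (\<forall>m. Poly_Mapping.lookup p m \<noteq> 0 \<longrightarrow> Poly_Mapping.keys m \<subseteq> {1..n})"
  by (simp add: poly_ring_def in_keys_iff Ball_def)

lemma polys_0 [simp]: "0 \<in> polys n"
  by (simp add: polys_iff)

lemma polys_1 [simp]: "1 \<in> polys n"
  by (auto simp: polys_iff lookup_one when_def split: if_splits)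

lemma polys_add [simp]: "p \<in> polys n \<Longrightarrow> q \<in> polys n \<Longrightarrow> p + q \<in> polys n"
  unfolding polys_iff lookup_add by (metis add_0)

lemma polys_uminus [simp]: "p \<in> polys n \<Longrightarrow> - p \<in> polys n"
  by (simp add: polys_iff)

lemma polys_diff [simp]: "p \<in> polys n \<Longrightarrow> q \<in> polys n \<Longrightarrow> p - q \<in> polys n"
  using polys_add[of p n "- q"] by simp

lemma polys_mult [simp]:
  assumes "p \<in> polys n" "q \<in> polys n"
  shows "p * q \<in> polys n"
proof -
  have "Poly_Mapping.keys m \<subseteq> {1..n}" if m: "m \<in> Poly_Mapping.keys (p * q)" for m
  proof -
    obtain a b where "m = a + b" "a \<in> Poly_Mapping.keys p" "b \<in> Poly_Mapping.keys q"
      using keys_mult[of p q] m by blast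
    then show ?thesis using assms by (simp add: poly_ring_def keys_add_nat)
  qed
  then show ?thesis by (simp add: poly_ring_def)
qed

lemma polys_sum [simp]: "(\<And>i. i \<in> I \<Longrightarrow> f i \<in> polys n) \<Longrightarrow> (\<Sum>i\<in>I. f i) \<in> polys n"
  by (induction I rule: infinite_finite_induct) auto

lemma polys_single [simp]: "Poly_Mapping.keys m \<subseteq> {1..n} \<Longrightarrow> Poly_Mapping.single m c \<in> polys n"
  by (auto simp: poly_ring_def)

lemma cring_poly_ring: "cring (poly_ring n :: 'k::field mpoly ring)"
proof (rule cringI)
  show "abelian_group (poly_ring n :: 'k mpoly ring)"
  proof (rule abelian_groupI)
    fix p :: "'k mpoly" assume "p \<in> polys n"
    then show "\<exists>q\<in>polys n. q \<oplus>\<^bsub>poly_ring n\<^esub> p = \<zero>\<^bsub>poly_ring n\<^esub>"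
      by (intro bexI[of _ "- p"]) auto
  qed (auto simp: add.assoc add.commute)
  show "comm_monoid (poly_ring n :: 'k mpoly ring)"
    by (rule comm_monoidI) (auto simp: mult.assoc mult.commute)
qed (auto simp: distrib_right)

lemma lookup_single_mult: "Poly_Mapping.lookup (Poly_Mapping.single m c * p) (m + b :: nat \<Rightarrow>\<^sub>0 nat) = c * Poly_Mapping.lookup p b"
  by (simp add: lookup_mult lookup_single when_mult)

lemma lookup_single_mult_0:
  "(\<And>b. k \<noteq> m + b) \<Longrightarrow> Poly_Mapping.lookup (Poly_Mapping.single m c * p) (k :: nat \<Rightarrow>\<^sub>0 nat) = 0"
  by (simp add: lookup_mult lookup_single when_mult)

lemma lookup_single_mult_scale:
  "Poly_Mapping.lookup (Poly_Mapping.single m c * p) (k :: nat \<Rightarrow>\<^sub>0 nat)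
    = c * Poly_Mapping.lookup (Poly_Mapping.single m 1 * p :: 'k::field mpoly) k"
proof (cases "\<exists>b. k = m + b")
  case True
  then show ?thesis by (auto simp: lookup_single_mult)
qed (simp add: lookup_single_mult_0)

definition sqfree_monomial :: "nat set \<Rightarrow> nat \<Rightarrow>\<^sub>0 nat" where
  "sqfree_monomial A = (\<Sum>i\<in>A. Poly_Mapping.single i 1)"

lemma lookup_sqfree_monomial: "finite A \<Longrightarrow> Poly_Mapping.lookup (sqfree_monomial A) i = (if i \<in> A then 1 else 0)"
  by (simp add: sqfree_monomial_def lookup_sum lookup_single when_def)

lemma keys_sqfree_monomial [simp]: "finite A \<Longrightarrow> Poly_Mapping.keys (sqfree_monomial A) = A"
  by (auto simp: in_keys_iff lookup_sqfree_monomial split: if_splits)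

lemma total_degree_sqfree_monomial [simp]: "finite A \<Longrightarrow> total_degree (sqfree_monomial A) = card A"
  by (simp add: total_degree_def lookup_sqfree_monomial)

lemma sqfree_monomial_diff:
  "finite B \<Longrightarrow> A \<subseteq> B \<Longrightarrow> sqfree_monomial A + sqfree_monomial (B - A) = sqfree_monomial B"
  using finite_subset[of A B] by (auto simp: lookup_add lookup_sqfree_monomial intro!: poly_mapping_eqI)

lemma sqfree_monomial_dvd:
  assumes "finite A" "A \<subseteq> Poly_Mapping.keys m"
  shows "sqfree_monomial A + (m - sqfree_monomial A) = m"
proof (rule poly_mapping_eqI)
  fix i
  have "i \<in> A \<Longrightarrow> Poly_Mapping.lookup m i \<noteq> 0" using assms by (auto simp: in_keys_iff)
  then show "Poly_Mapping.lookup (sqfree_monomial A + (m - sqfree_monomial A)) i = Poly_Mapping.lookup m i"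
    using assms by (simp add: lookup_add lookup_minus lookup_sqfree_monomial)
qed

lemma prod_indet: "finite F \<Longrightarrow> (\<Prod>i\<in>F. indet i) = Poly_Mapping.single (sqfree_monomial F) 1"
  by (induction F rule: finite_induct) (simp_all add: sqfree_monomial_def indet_def mult_single)

lemma lookup_sqfree_mult_nonzero:
  assumes "finite A" "Poly_Mapping.lookup (Poly_Mapping.single (sqfree_monomial A) c * p) b \<noteq> 0"
  shows "A \<subseteq> Poly_Mapping.keys b"
proof -
  obtain b' where "b = sqfree_monomial A + b'" using assms(2) lookup_single_mult_0 by blast
  then show ?thesis using assms(1) by (simp add: keys_add_nat)
qed

text \<open>The part of \<open>v\<close> in the multidegree \<open>b\<close>, for the grading of the free
  module in which the \<open>k\<close>-th basis element has degree \<open>A k\<close>.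
  Multiplication by the monomial of \<open>A k\<close> shifts the \<open>k\<close>-th coordinate to
  its true degree, which avoids subtraction of exponents.\<close>

definition component ::
  "nat \<Rightarrow> (nat \<Rightarrow> nat set) \<Rightarrow> 'k::field mpoly vec \<Rightarrow> (nat \<Rightarrow>\<^sub>0 nat) \<Rightarrow> nat \<Rightarrow> 'k" where
  "component r A v b = (\<lambda>k. if k < r
     then Poly_Mapping.lookup (Poly_Mapping.single (sqfree_monomial (A k)) 1 * v $ k) b else 0)"

text \<open>The multigraded matrix with coefficients \<open>g\<close>: the monomial in the entry \<open>(k,
  l)\<close> makes up for the difference of the degrees of the two basis elements.\<close>

definition sqfree_mat ::
  "nat \<Rightarrow> (nat \<Rightarrow> nat set) \<Rightarrow> nat \<Rightarrow> (nat \<Rightarrow> nat set) \<Rightarrow> (nat \<Rightarrow> nat \<Rightarrow> 'k::field) \<Rightarrow> 'k mpoly mat" where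
  "sqfree_mat r A r' A' g = mat r r' (\<lambda>(k, l).
     if A k \<subseteq> A' l then Poly_Mapping.single (sqfree_monomial (A' l - A k)) (g l k) else 0)"

text \<open>The module over the polynomial ring that corresponds to a nested system: the part in a multidegree
  \<open>b\<close> depends only on the support of \<open>b\<close>.\<close>

definition system_module ::
  "nat \<Rightarrow> (nat set \<Rightarrow> (nat \<Rightarrow> 'k::field) set) \<Rightarrow> nat \<Rightarrow> (nat \<Rightarrow> nat set) \<Rightarrow> 'k mpoly vec set" where
  "system_module n M r A = {v \<in> free_mod n r.
     \<forall>b. Poly_Mapping.keys b \<subseteq> {1..n} \<longrightarrow> component r A v b \<in> M (Poly_Mapping.keys b)}"

lemma free_modD: "v \<in> free_mod n r \<Longrightarrow> k < r \<Longrightarrow> v $ k \<in> polys n" "v \<in> free_mod n r \<Longrightarrow> dim_vec v = r"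
  by (auto simp: free_mod_def)

lemma component_free_system:
  assumes "\<And>k. k < r \<Longrightarrow> finite (A k)"
  shows "component r A v b \<in> free_system r A (Poly_Mapping.keys b)"
  using assms lookup_sqfree_mult_nonzero
  by (fastforce simp: free_system_def component_def split: if_splits)

lemma component_eq_0:
  assumes v: "v \<in> free_mod n r" and A: "\<And>k. k < r \<Longrightarrow> A k \<subseteq> {1..n}"
    and b: "\<not> Poly_Mapping.keys b \<subseteq> {1..n}"
  shows "component r A v b = (\<lambda>_. 0)"
proof
  fix k show "component r A v b k = 0"
  proof (cases "k < r")
    case True
    then have "finite (A k)" using A finite_subset by blast
    then have "Poly_Mapping.single (sqfree_monomial (A k)) 1 * v $ k \<in> polys n"
      using True A free_modD[OF v] by (intro polys_mult polys_single) auto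
    then show ?thesis using b by (auto simp: component_def polys_iff)
  qed (simp add: component_def)
qed

lemma component_inject:
  assumes "v \<in> free_mod n r" "w \<in> free_mod n r" and eq: "\<And>b. component r A v b = component r A w b"
  shows "v = w"
proof (rule eq_vecI)
  fix k assume "k < dim_vec w"
  then have k: "k < r" using assms free_modD by metis
  show "v $ k = w $ k"
  proof (rule poly_mapping_eqI)
    fix b
    show "Poly_Mapping.lookup (v $ k) b = Poly_Mapping.lookup (w $ k) b"
      using fun_cong[OF eq[of "sqfree_monomial (A k) + b"], of k] k
      by (simp add: component_def lookup_single_mult)
  qed
qed (use assms free_modD in metis)

lemma component_surj:
  assumes A: "\<And>k. k < r \<Longrightarrow> A k \<subseteq> {1..n}" and fin: "finite B"
    and B: "\<And>b. b \<in> B \<Longrightarrow> Poly_Mapping.keys b \<subseteq> {1..n}"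
    and f: "\<And>b. b \<in> B \<Longrightarrow> f b \<in> free_system r A (Poly_Mapping.keys b)"
    and f0: "\<And>b. b \<notin> B \<Longrightarrow> f b = (\<lambda>_. 0)"
  shows "\<exists>w\<in>free_mod n r. \<forall>b. component r A w b = f b"
proof -
  define T where "T k = {b \<in> B. A k \<subseteq> Poly_Mapping.keys b}" for k
  define w where "w = vec r (\<lambda>k. \<Sum>b\<in>T k. Poly_Mapping.single (b - sqfree_monomial (A k)) (f b k))"
  have finA: "finite (A k)" if "k < r" for k using A[OF that] finite_subset by blast
  have split: "sqfree_monomial (A k) + (b - sqfree_monomial (A k)) = b" if "k < r" "b \<in> T k" for k b
    using sqfree_monomial_dvd[OF finA[OF that(1)]] that(2) by (simp add: T_def)
  have "Poly_Mapping.keys (b - sqfree_monomial (A k)) \<subseteq> {1..n}" if "k < r" "b \<in> T k" for k b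
  proof -
    have "Poly_Mapping.keys (b - sqfree_monomial (A k)) \<subseteq> Poly_Mapping.keys b"
      by (subst (2) split[OF that, symmetric]) (simp add: keys_add_nat)
    then show ?thesis using B[of b] that(2) by (auto simp: T_def)
  qed
  then have "w \<in> free_mod n r"
    unfolding free_mod_def w_def by (auto intro!: polys_sum polys_single)
  moreover have "component r A w b = f b" for b
  proof
    fix k show "component r A w b k = f b k"
    proof (cases "k < r")
      case True
      have "Poly_Mapping.single (sqfree_monomial (A k)) 1 * w $ k = (\<Sum>b\<in>T k. Poly_Mapping.single b (f b k))"
        using True by (simp add: w_def sum_distrib_left mult_single split cong: sum.cong)
      then have "component r A w b k = (\<Sum>b'\<in>T k. (f b' k when b' = b))"
        using True by (simp add: component_def lookup_sum lookup_single)
      also have "\<dots> = (if b \<in> T k then f b k else 0)"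
        using fin by (simp add: when_def T_def)
      also have "\<dots> = f b k" using f[of b] f0[of b] by (cases "b \<in> B") (auto simp: T_def free_system_def)
      finally show ?thesis .
    next
      case False
      have "f b k = 0" using f[of b] f0[of b] False by (cases "b \<in> B") (auto simp: free_system_def)
      then show ?thesis using False by (simp add: component_def)
    qed
  qed
  ultimately show ?thesis by blast
qed

locale sqfree_map =
  fixes n r r' :: nat and A A' :: "nat \<Rightarrow> nat set" and g :: "nat \<Rightarrow> nat \<Rightarrow> 'k::field"
  assumes A: "\<And>k. k < r \<Longrightarrow> A k \<subseteq> {1..n}" and A': "\<And>l. l < r' \<Longrightarrow> A' l \<subseteq> {1..n}"
    and g: "\<And>l. l < r' \<Longrightarrow> g l \<in> free_system r A (A' l)"
begin

abbreviation "D \<equiv> sqfree_mat r A r' A' g"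

lemma finite_A: "k < r \<Longrightarrow> finite (A k)"
  using A[of k] finite_subset by blast

lemma finite_A': "l < r' \<Longrightarrow> finite (A' l)"
  using A'[of l] finite_subset by blast

lemma D_entry:
  assumes "k < r" "l < r'"
  shows "D $$ (k, l) \<in> polys n"
proof -
  have "A' l - A k \<subseteq> {1..n}" using A'[OF assms(2)] by blast
  then show ?thesis using assms finite_A' by (simp add: sqfree_mat_def)
qed

lemma D_mult_index: "w \<in> free_mod n r' \<Longrightarrow> k < r \<Longrightarrow> (D *\<^sub>v w) $ k = (\<Sum>l<r'. D $$ (k, l) * w $ l)"
  by (auto simp: sqfree_mat_def scalar_prod_def free_modD lessThan_atLeast0 intro!: sum.cong)

lemma D_mult_mem:
  assumes w: "w \<in> free_mod n r'"
  shows "D *\<^sub>v w \<in> free_mod n r"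
proof -
  have "(D *\<^sub>v w) $ k \<in> polys n" if "k < r" for k
    unfolding D_mult_index[OF w that]
    by (intro polys_sum polys_mult) (use D_entry[OF that] free_modD(1)[OF w] in auto)
  moreover have "D *\<^sub>v w \<in> carrier_vec r" by (rule carrier_vecI) (simp add: sqfree_mat_def)
  ultimately show ?thesis by (simp add: free_mod_def)
qed

text \<open>In each multidegree the matrix acts by its coefficients. This reduces statements about the
  polynomial ring to linear algebra over the field.\<close>

lemma component_mult:
  assumes w: "w \<in> free_mod n r'"
  shows "component r A (D *\<^sub>v w) b = comb r' g (component r' A' w b)"
proof
  fix k
  show "component r A (D *\<^sub>v w) b k = comb r' g (component r' A' w b) k"
  proof (cases "k < r")
    case True
    have entry: "Poly_Mapping.single (sqfree_monomial (A k)) 1 * D $$ (k, l)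
        = Poly_Mapping.single (sqfree_monomial (A' l)) (g l k)" if "l < r'" for l
    proof (cases "A k \<subseteq> A' l")
      case True
      then show ?thesis
        using \<open>k < r\<close> that by (simp add: sqfree_mat_def mult_single sqfree_monomial_diff finite_A')
    next
      case False
      then have "g l k = 0" using g[OF that] by (auto simp: free_system_def)
      then show ?thesis using \<open>k < r\<close> that by (simp add: sqfree_mat_def)
    qed
    have "Poly_Mapping.single (sqfree_monomial (A k)) 1 * (D *\<^sub>v w) $ k
        = (\<Sum>l<r'. Poly_Mapping.single (sqfree_monomial (A' l)) (g l k) * w $ l)"
      using True w by (simp add: D_mult_index sum_distrib_left entry flip: mult.assoc del: index_mult_mat_vec)
    then have "component r A (D *\<^sub>v w) b k
        = (\<Sum>l<r'. Poly_Mapping.lookup (Poly_Mapping.single (sqfree_monomial (A' l)) (g l k) * w $ l) b)"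
      using True by (simp add: component_def lookup_sum)
    also have "\<dots> = comb r' g (component r' A' w b) k"
      unfolding comb_def component_def
      by (intro sum.cong refl) (subst lookup_single_mult_scale, simp)
    finally show ?thesis .
  next
    case False
    have "g l k = 0" if "l < r'" for l using g[OF that] False by (auto simp: free_system_def)
    then show ?thesis using False by (simp add: component_def comb_def)
  qed
qed

text \<open>Only finitely many multidegrees of \<open>v\<close> are nonzero, and in each of them a preimage is
  found over the field.\<close>

lemma image_eq_system_module:
  assumes M: "nested_system n N M" and gen: "generates n M r' A' g"
  shows "(\<lambda>w. D *\<^sub>v w) ` free_mod n r' = system_module n M r A"
proof (intro equalityI subsetI)
  fix v assume "v \<in> (\<lambda>w. D *\<^sub>v w) ` free_mod n r'"
  then obtain w where w: "w \<in> free_mod n r'" "v = D *\<^sub>v w" by blast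
  have "component r A v b \<in> M (Poly_Mapping.keys b)" if "Poly_Mapping.keys b \<subseteq> {1..n}" for b
    unfolding w(2) component_mult[OF w(1)]
    by (rule comb_free_system_mem[OF M gen that component_free_system[OF finite_A']])
  then show "v \<in> system_module n M r A"
    using D_mult_mem[OF w(1)] w(2) by (simp add: system_module_def)
next
  fix v assume v: "v \<in> system_module n M r A"
  then have v_mem: "v \<in> free_mod n r" by (simp add: system_module_def)
  define B where "B = {b. component r A v b \<noteq> (\<lambda>_. 0)}"
  have "B \<subseteq> (\<Union>k<r. Poly_Mapping.keys (Poly_Mapping.single (sqfree_monomial (A k)) 1 * v $ k))"
    by (auto simp: B_def component_def fun_eq_iff in_keys_iff)
  then have fin: "finite B" using finite_subset by fastforce
  have B: "Poly_Mapping.keys b \<subseteq> {1..n}" if "b \<in> B" for b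
    using that component_eq_0[where A = A and b = b, OF v_mem A] unfolding B_def by blast
  have "\<forall>b\<in>B. \<exists>f. f \<in> free_system r' A' (Poly_Mapping.keys b) \<and> comb r' g f = component r A v b"
  proof
    fix b assume "b \<in> B"
    then have "component r A v b \<in> M (Poly_Mapping.keys b)"
      using v B by (simp add: system_module_def)
    then show "\<exists>f. f \<in> free_system r' A' (Poly_Mapping.keys b) \<and> comb r' g f = component r A v b"
      using gen B[OF \<open>b \<in> B\<close>] unfolding generates_def by blast
  qed
  then obtain f where f: "\<forall>b\<in>B. f b \<in> free_system r' A' (Poly_Mapping.keys b) \<and> comb r' g (f b) = component r A v b"
    by (rule bchoice[THEN exE])
  obtain w where w: "w \<in> free_mod n r'" "\<And>b. component r' A' w b = (if b \<in> B then f b else (\<lambda>_. 0))"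
    using component_surj[where A = A' and r = r' and f = "\<lambda>b. if b \<in> B then f b else (\<lambda>_. 0)", OF A' fin B] f by auto
  have "component r A (D *\<^sub>v w) b = component r A v b" for b
    unfolding component_mult[OF w(1)] w(2) using f by (auto simp: B_def comb_def)
  then have "D *\<^sub>v w = v" by (rule component_inject[OF D_mult_mem[OF w(1)] v_mem])
  then show "v \<in> (\<lambda>w. D *\<^sub>v w) ` free_mod n r'" using w(1) by blast
qed

lemma kernel_eq_system_module:
  "{w \<in> free_mod n r'. D *\<^sub>v w = 0\<^sub>v r} = system_module n (syzygies r' A' g) r' A'"
proof -
  have "D *\<^sub>v w = 0\<^sub>v r \<longleftrightarrow>
      (\<forall>b. Poly_Mapping.keys b \<subseteq> {1..n} \<longrightarrow> component r' A' w b \<in> syzygies r' A' g (Poly_Mapping.keys b))"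
    if w: "w \<in> free_mod n r'" for w
  proof -
    have zero: "0\<^sub>v r \<in> free_mod n r" by (simp add: free_mod_def)
    have comp0: "component r A (0\<^sub>v r) b = (\<lambda>_. 0)" for b by (auto simp: component_def)
    have "D *\<^sub>v w = 0\<^sub>v r \<longleftrightarrow> (\<forall>b. component r A (D *\<^sub>v w) b = (\<lambda>_. 0))"
    proof
      assume *: "\<forall>b. component r A (D *\<^sub>v w) b = (\<lambda>_. 0)"
      show "D *\<^sub>v w = 0\<^sub>v r"
        by (rule component_inject[OF D_mult_mem[OF w] zero, of A]) (simp only: * comp0)
    qed (simp only: comp0 simp_thms)
    also have "\<dots> \<longleftrightarrow> (\<forall>b. comb r' g (component r' A' w b) = (\<lambda>_. 0))"
      by (simp add: component_mult[OF w])
    also have "\<dots> \<longleftrightarrow> (\<forall>b. Poly_Mapping.keys b \<subseteq> {1..n} \<longrightarrow> comb r' g (component r' A' w b) = (\<lambda>_. 0))"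
    proof -
      have "comb r' g (component r' A' w b) = (\<lambda>_. 0)" if "\<not> Poly_Mapping.keys b \<subseteq> {1..n}" for b
        using component_eq_0[OF w A' that] by (simp add: comb_def)
      then show ?thesis by blast
    qed
    finally show ?thesis
      using component_free_system[where A = A' and r = r' and v = w, OF finite_A']
      by (simp add: syzygies_def fun_eq_iff)
  qed
  then show ?thesis by (auto simp: system_module_def)
qed

end

lemma monomial_ideal:
  assumes P: "\<And>K L. P K \<Longrightarrow> K \<subseteq> L \<Longrightarrow> P L"
  shows "ideal {p \<in> polys n. \<forall>m \<in> Poly_Mapping.keys p. P (Poly_Mapping.keys m)}
    (poly_ring n :: 'k::field mpoly ring)" (is "ideal ?I _")
proof -
  interpret R: cring "poly_ring n :: 'k mpoly ring" by (rule cring_poly_ring)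
  have mult: "x * p \<in> ?I" if p: "p \<in> ?I" and x: "x \<in> polys n" for p x :: "'k mpoly"
  proof -
    have "P (Poly_Mapping.keys m)" if m: "m \<in> Poly_Mapping.keys (x * p)" for m
    proof -
      obtain a b where "m = a + b" "b \<in> Poly_Mapping.keys p"
        using keys_mult[of x p] m by blast
      then show ?thesis using p P[of "Poly_Mapping.keys b"] by (simp add: keys_add_nat)
    qed
    then show ?thesis using p x by simp
  qed
  show ?thesis
  proof (rule idealI)
    show "ring (poly_ring n :: 'k mpoly ring)" by (rule R.ring_axioms)
    show "subgroup ?I (add_monoid (poly_ring n))"
    proof (rule subgroup.intro)
      fix p assume p: "p \<in> ?I"
      have "\<ominus>\<^bsub>poly_ring n\<^esub> p = - p"
        using p by (intro R.minus_equality) auto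
      then show "inv\<^bsub>add_monoid (poly_ring n)\<^esub> p \<in> ?I"
        using p by (simp add: a_inv_def in_keys_iff)
      fix q assume q: "q \<in> ?I"
      have "p + q \<in> ?I"
        using p q Poly_Mapping.keys_add[of p q] by auto
      then show "p \<otimes>\<^bsub>add_monoid (poly_ring n)\<^esub> q \<in> ?I" by simp
    qed auto
  qed (use mult in \<open>simp_all add: mult.commute\<close>)
qed

lemma poly_in_ideal:
  assumes I: "ideal I (poly_ring n)" and p: "p \<in> polys n"
    and single: "\<And>m c. m \<in> Poly_Mapping.keys p \<Longrightarrow> Poly_Mapping.single m c \<in> I"
  shows "p \<in> (I :: 'k::field mpoly set)"
proof -
  interpret I: ideal I "poly_ring n" by (rule I)
  have sum: "(\<Sum>m\<in>X. Poly_Mapping.single m (Poly_Mapping.lookup p m)) \<in> I"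
    if "finite X" "X \<subseteq> Poly_Mapping.keys p" for X
    using that
  proof (induction X)
    case empty
    then show ?case using additive_subgroup.zero_closed[OF I.additive_subgroup_axioms] by simp
  next
    case (insert m X)
    then show ?case using single additive_subgroup.a_closed[OF I.additive_subgroup_axioms] by auto
  qed
  have "p = (\<Sum>m\<in>Poly_Mapping.keys p. Poly_Mapping.single m (Poly_Mapping.lookup p m))"
    by (rule poly_mapping_eqI) (simp add: lookup_sum lookup_single when_def in_keys_iff)
  then show ?thesis using sum[of "Poly_Mapping.keys p"] by simp
qed

text \<open>Membership in an ideal generated by squarefree monomials can be read off the supports of the
  exponents. Both the circuit ideals and the irrelevant ideal are instances.\<close>

lemma genideal_monomials:
  assumes P: "\<And>K L. P K \<Longrightarrow> K \<subseteq> L \<Longrightarrow> P L" and D: "\<And>F. F \<in> \<D> \<Longrightarrow> F \<subseteq> {1..n}"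
    and PD: "\<And>K. P K \<longleftrightarrow> (\<exists>F\<in>\<D>. F \<subseteq> K)"
  shows "Idl\<^bsub>poly_ring n\<^esub> ((\<lambda>F. Poly_Mapping.single (sqfree_monomial F) (1::'k::field)) ` \<D>)
    = {p \<in> polys n. \<forall>m \<in> Poly_Mapping.keys p. P (Poly_Mapping.keys m)}" (is "Idl\<^bsub>_\<^esub> ?G = ?I")
proof
  interpret R: cring "poly_ring n :: 'k mpoly ring" by (rule cring_poly_ring)
  have fin: "finite F" if "F \<in> \<D>" for F using D[OF that] finite_subset by blast
  have G: "?G \<subseteq> polys n" by (intro image_subsetI polys_single) (simp only: keys_sqfree_monomial fin D)
  show "Idl\<^bsub>poly_ring n\<^esub> ?G \<subseteq> ?I"
  proof (rule R.genideal_minimal[OF monomial_ideal[OF P]])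
    show "?G \<subseteq> ?I" using G fin PD by auto
  qed
  show "?I \<subseteq> Idl\<^bsub>poly_ring n\<^esub> ?G"
  proof
    fix p assume p: "p \<in> ?I"
    have I: "ideal (Idl\<^bsub>poly_ring n\<^esub> ?G) (poly_ring n)" by (rule R.genideal_ideal[OF G])
    show "p \<in> Idl\<^bsub>poly_ring n\<^esub> ?G"
    proof (rule poly_in_ideal[OF I])
      fix m and c :: 'k assume m: "m \<in> Poly_Mapping.keys p"
      then obtain F where F: "F \<in> \<D>" "F \<subseteq> Poly_Mapping.keys m" using p PD by auto
      let ?m' = "m - sqfree_monomial F"
      have split: "sqfree_monomial F + ?m' = m" by (rule sqfree_monomial_dvd[OF fin[OF F(1)] F(2)])
      have "Poly_Mapping.keys m \<subseteq> {1..n}" using p m by (simp add: poly_ring_def)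
      then have "Poly_Mapping.keys ?m' \<subseteq> {1..n}"
        using arg_cong[OF split, of Poly_Mapping.keys] unfolding keys_add_nat by blast
      then have "Poly_Mapping.single ?m' c \<in> polys n" by simp
      moreover have "Poly_Mapping.single (sqfree_monomial F) 1 \<in> Idl\<^bsub>poly_ring n\<^esub> ?G"
        using R.genideal_self[OF G] F(1) by blast
      ultimately have "Poly_Mapping.single (sqfree_monomial F) 1 * Poly_Mapping.single ?m' c \<in> Idl\<^bsub>poly_ring n\<^esub> ?G"
        using ideal.I_r_closed[OF I] by fastforce
      then show "Poly_Mapping.single m c \<in> Idl\<^bsub>poly_ring n\<^esub> ?G"
        by (simp add: mult_single split)
    qed (use p in simp)
  qed
qed

lemma circuit_ideal_eq:
  assumes "\<And>F. F \<in> \<D> \<Longrightarrow> F \<subseteq> {1..n}"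
  shows "(circuit_ideal n \<D> :: 'k::field mpoly set) = {p \<in> polys n. \<forall>m \<in> Poly_Mapping.keys p. \<exists>F\<in>\<D>. F \<subseteq> Poly_Mapping.keys m}"
proof -
  have "(\<lambda>F. \<Prod>i\<in>F. indet i :: 'k mpoly) ` \<D> = (\<lambda>F. Poly_Mapping.single (sqfree_monomial F) 1) ` \<D>"
    using assms by (intro image_cong refl prod_indet) (meson finite_atLeastAtMost finite_subset)
  moreover have "Idl\<^bsub>poly_ring n\<^esub> ((\<lambda>F. Poly_Mapping.single (sqfree_monomial F) (1::'k)) ` \<D>)
      = {p \<in> polys n. \<forall>m \<in> Poly_Mapping.keys p. \<exists>F\<in>\<D>. F \<subseteq> Poly_Mapping.keys m}"
  proof (rule genideal_monomials)
    show "\<exists>F\<in>\<D>. F \<subseteq> L" if "\<exists>F\<in>\<D>. F \<subseteq> K" "K \<subseteq> L" for K L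
      using that by (meson subset_trans)
  qed (use assms in simp_all)
  ultimately show ?thesis by (simp add: circuit_ideal_def)
qed

lemma irrelevant_ideal_eq: "irrelevant_ideal n = {p \<in> polys n. Poly_Mapping.lookup p 0 = 0}"
proof -
  have eq: "indet ` {1..n} = (\<lambda>F. Poly_Mapping.single (sqfree_monomial F) 1) ` (\<lambda>i. {i}) ` {1..n}"
    by (simp add: image_image sqfree_monomial_def indet_def[abs_def])
  have "irrelevant_ideal n = {p \<in> polys n. \<forall>m \<in> Poly_Mapping.keys p. \<exists>F\<in>(\<lambda>i. {i}) ` {1..n}. F \<subseteq> Poly_Mapping.keys m}"
    unfolding irrelevant_ideal_def eq by (rule genideal_monomials) auto
  also have "\<dots> = {p \<in> polys n. Poly_Mapping.lookup p 0 = 0}"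
  proof -
    have "(\<forall>m \<in> Poly_Mapping.keys p. \<exists>F\<in>(\<lambda>i. {i}) ` {1..n}. F \<subseteq> Poly_Mapping.keys m) \<longleftrightarrow> Poly_Mapping.lookup p 0 = 0"
      if p: "p \<in> polys n" for p
    proof -
      have "(\<exists>F\<in>(\<lambda>i. {i}) ` {1..n}. F \<subseteq> Poly_Mapping.keys m) \<longleftrightarrow> m \<noteq> 0"
        if "m \<in> Poly_Mapping.keys p" for m
      proof -
        have "Poly_Mapping.keys m \<subseteq> {1..n}" using p that by (simp add: poly_ring_def)
        moreover have "Poly_Mapping.keys m = {} \<longleftrightarrow> m = 0"
          by (metis keys_zero poly_mapping_eqI lookup_zero empty_iff in_keys_iff)
        ultimately show ?thesis by blast
      qed
      then show ?thesis by (auto simp: in_keys_iff)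
    qed
    then show ?thesis by blast
  qed
  finally show ?thesis .
qed

section \<open>The minimal resolution of a circuit ideal\<close>

lemma (in sqfree_map) D_homogeneous:
  assumes "k < r" "l < r'"
  shows "homogeneous (int (card (A' l)) - int (card (A k))) (D $$ (k, l))"
proof (cases "A k \<subseteq> A' l")
  case True
  have "card (A k) \<le> card (A' l)" using True finite_A'[OF assms(2)] by (rule card_mono[rotated])
  then have "int (card (A' l - A k)) = int (card (A' l)) - int (card (A k))"
    using True finite_A[OF assms(1)] by (simp add: card_Diff_subset)
  then show ?thesis
    using assms True finite_A'[OF assms(2)] by (auto simp: sqfree_mat_def homogeneous_def split: if_splits)
qed (use assms in \<open>simp add: sqfree_mat_def homogeneous_def\<close>)

lemma (in sqfree_map) D_irrelevant:
  assumes "k < r" "l < r'" and "g l k \<noteq> 0 \<Longrightarrow> A k \<subset> A' l"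
  shows "D $$ (k, l) \<in> irrelevant_ideal n"
proof -
  have "Poly_Mapping.lookup (D $$ (k, l)) 0 = 0"
  proof (cases "A k \<subseteq> A' l \<and> g l k \<noteq> 0")
    case True
    then obtain i where "i \<in> A' l - A k" using assms(3) by blast
    then have "Poly_Mapping.lookup (sqfree_monomial (A' l - A k)) i \<noteq> Poly_Mapping.lookup 0 i"
      using finite_A'[OF assms(2)] by (simp add: lookup_sqfree_monomial)
    then have "sqfree_monomial (A' l - A k) \<noteq> 0" by auto
    then show ?thesis using assms(1,2) by (simp add: sqfree_mat_def lookup_single when_def)
  next
    case False
    then show ?thesis using assms(1,2) by (auto simp: sqfree_mat_def)
  qed
  then show ?thesis using D_entry[OF assms(1,2)] by (simp add: irrelevant_ideal_eq)
qed

context squarefree_resolution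
begin

definition diff_mat :: "nat \<Rightarrow> 'k mpoly mat" where
  "diff_mat i = sqfree_mat (r i) (A i) (r (Suc i)) (A (Suc i)) (g (Suc i))"

definition augmentation :: "'k mpoly vec" where
  "augmentation = row (sqfree_mat 1 (\<lambda>_. {}) (r 0) (A 0) (g 0)) 0"

lemma M_Suc_subset: "M (Suc i) W \<subseteq> free_system (r i) (A i) W"
  by (auto simp: M_Suc syzygies_def)

lemma sqfree_map_Suc: "sqfree_map n (r i) (r (Suc i)) (A i) (A (Suc i)) (g (Suc i))"
  by unfold_locales (use A_subset g_mem M_Suc_subset in blast)+

text \<open>The image of each matrix and the kernel of the preceding one are the same squarefree module. The
  entries lie in the irrelevant ideal because the degrees of the generators grow strictly.\<close>

lemma minimal_graded_free_resolution_circuit_ideal: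
  assumes M0: "M 0 = ideal_system \<D>" and \<D>: "\<And>F. F \<in> \<D> \<Longrightarrow> F \<subseteq> {1..n}"
  shows "minimal_graded_free_resolution n (circuit_ideal n \<D>) r (\<lambda>i k. int (card (A i k)))
    augmentation diff_mat"
proof -
  have g0: "g 0 l \<in> free_system 1 (\<lambda>_. {}) (A 0 l)" if "l < r 0" for l
    using g_mem[OF that] by (auto simp: M0 ideal_system_def free_system_def)
  interpret S0: sqfree_map n 1 "r 0" "\<lambda>_. {}" "A 0" "g 0"
    by unfold_locales (use A_subset g0 in auto)
  interpret S: sqfree_map n "r i" "r (Suc i)" "A i" "A (Suc i)" "g (Suc i)" for i
    by (rule sqfree_map_Suc)
  have aug: "augmentation \<bullet> v = (S0.D *\<^sub>v v) $ 0" for v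
    by (simp add: augmentation_def sqfree_mat_def)
  have aug_index: "augmentation $ k = S0.D $$ (0, k)" if "k < r 0" for k
    using that by (simp add: augmentation_def sqfree_mat_def)
  have ker0: "{v \<in> free_mod n (r 0). augmentation \<bullet> v = 0} = system_module n (M 1) (r 0) (A 0)"
  proof -
    have "augmentation \<bullet> v = 0 \<longleftrightarrow> S0.D *\<^sub>v v = 0\<^sub>v 1" for v
    proof -
      have "dim_vec (S0.D *\<^sub>v v) = 1" by (simp add: sqfree_mat_def)
      then show ?thesis unfolding aug by (auto simp: vec_eq_iff)
    qed
    then show ?thesis using S0.kernel_eq_system_module by (simp add: M_Suc)
  qed
  have im0: "(\<lambda>v. augmentation \<bullet> v) ` free_mod n (r 0) = circuit_ideal n \<D>"
  proof -
    have "(\<lambda>v. augmentation \<bullet> v) ` free_mod n (r 0) = (\<lambda>v. v $ 0) ` system_module n (M 0) 1 (\<lambda>_. {})"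
      using S0.image_eq_system_module[OF nested_0 generating, symmetric]
      by (simp add: aug image_image)
    also have "\<dots> = circuit_ideal n \<D>"
    proof (intro equalityI subsetI)
      have comp: "component 1 (\<lambda>_. {}) v b \<in> M 0 (Poly_Mapping.keys b) \<longleftrightarrow>
          (Poly_Mapping.lookup (v $ 0) b \<noteq> 0 \<longrightarrow> (\<exists>F\<in>\<D>. F \<subseteq> Poly_Mapping.keys b))" for v b
        by (auto simp: component_def M0 ideal_system_def nonface_def sqfree_monomial_def)
      {
        fix p assume "p \<in> (\<lambda>v. v $ 0) ` system_module n (M 0) 1 (\<lambda>_. {})"
        then obtain v where v: "v \<in> system_module n (M 0) 1 (\<lambda>_. {})" "p = v $ 0" by blast
        then have p: "p \<in> polys n" by (simp add: system_module_def free_mod_def)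
        moreover have "\<exists>F\<in>\<D>. F \<subseteq> Poly_Mapping.keys m" if "m \<in> Poly_Mapping.keys p" for m
        proof -
          have "Poly_Mapping.keys m \<subseteq> {1..n}" using p that by (simp add: poly_ring_def)
          then have "component 1 (\<lambda>_. {}) v m \<in> M 0 (Poly_Mapping.keys m)"
            using v(1) unfolding system_module_def by blast
          then show ?thesis using comp v(2) that by (simp add: in_keys_iff)
        qed
        ultimately show "p \<in> circuit_ideal n \<D>" by (simp add: circuit_ideal_eq[OF \<D>])
      next
        fix p :: "'k mpoly" assume "p \<in> circuit_ideal n \<D>"
        then have p: "p \<in> polys n" "\<forall>m \<in> Poly_Mapping.keys p. \<exists>F\<in>\<D>. F \<subseteq> Poly_Mapping.keys m"
          by (simp_all add: circuit_ideal_eq[OF \<D>])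
        have "vec 1 (\<lambda>_. p) \<in> system_module n (M 0) 1 (\<lambda>_. {})"
          unfolding system_module_def comp using p by (simp add: free_mod_def in_keys_iff)
        then show "p \<in> (\<lambda>v. v $ 0) ` system_module n (M 0) 1 (\<lambda>_. {})"
          by (rule rev_image_eqI) simp
      }
    qed
    finally show ?thesis .
  qed
  have im: "(\<lambda>v. diff_mat i *\<^sub>v v) ` free_mod n (r (Suc i)) = system_module n (M (Suc i)) (r i) (A i)" for i
  proof -
    obtain N where "nested_system n N (M (Suc i))" using nested by blast
    then show ?thesis unfolding diff_mat_def by (rule S.image_eq_system_module[OF _ generating])
  qed
  have ker: "{v \<in> free_mod n (r (Suc i)). diff_mat i *\<^sub>v v = 0\<^sub>v (r i)}
      = system_module n (M (Suc (Suc i))) (r (Suc i)) (A (Suc i))" for i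
    unfolding diff_mat_def S.kernel_eq_system_module by (simp add: M_Suc)
  have aug_mem: "augmentation \<in> free_mod n (r 0)"
    using S0.D_entry by (auto simp: free_mod_def aug_index) (auto simp: augmentation_def sqfree_mat_def)
  have aug_hom: "homogeneous (int (card (A 0 k))) (augmentation $ k)" if "k < r 0" for k
    using S0.D_homogeneous[of 0 k] that by (simp add: aug_index)
  have d_dim: "diff_mat i \<in> carrier_mat (r i) (r (Suc i))" for i
    by (simp add: diff_mat_def sqfree_mat_def)
  have d_irr: "diff_mat i $$ (k, l) \<in> irrelevant_ideal n" if "k < r i" "l < r (Suc i)" for i k l
    unfolding diff_mat_def by (rule S.D_irrelevant[OF that]) (use g_Suc_strict[OF that(2)] in blast)
  show ?thesis
    unfolding minimal_graded_free_resolution_def graded_free_resolution_def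
    using aug_mem aug_hom d_dim d_irr im0 ker0 im ker S.D_entry S.D_homogeneous
    by (simp add: diff_mat_def)
qed

end

section \<open>Uniqueness of the graded Betti numbers\<close>

lemma total_degree_superset:
  "finite X \<Longrightarrow> Poly_Mapping.keys m \<subseteq> X \<Longrightarrow> total_degree m = (\<Sum>i\<in>X. Poly_Mapping.lookup m i)"
  unfolding total_degree_def by (rule sum.mono_neutral_left) (auto simp: in_keys_iff)

lemma total_degree_add: "total_degree (a + b) = total_degree a + total_degree b"
  using total_degree_superset[of "Poly_Mapping.keys a \<union> Poly_Mapping.keys b"]
  by (simp add: keys_add_nat lookup_add sum.distrib)

lemma homogeneousD: "homogeneous t p \<Longrightarrow> Poly_Mapping.lookup p m \<noteq> 0 \<Longrightarrow> int (total_degree m) = t"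
  by (simp add: homogeneous_def in_keys_iff)

lemma homogeneousI: "(\<And>m. Poly_Mapping.lookup p m \<noteq> 0 \<Longrightarrow> int (total_degree m) = t) \<Longrightarrow> homogeneous t p"
  by (simp add: homogeneous_def in_keys_iff)

lemma homogeneous_add: "homogeneous t p \<Longrightarrow> homogeneous t q \<Longrightarrow> homogeneous t (p + q)"
  using Poly_Mapping.keys_add[of p q] by (auto simp: homogeneous_def)

lemma homogeneous_0 [simp]: "homogeneous t 0"
  by (simp add: homogeneous_def)

lemma homogeneous_sum: "(\<And>i. i \<in> I \<Longrightarrow> homogeneous t (f i)) \<Longrightarrow> homogeneous t (\<Sum>i\<in>I. f i)"
  by (induction I rule: infinite_finite_induct) (auto intro: homogeneous_add)

lemma homogeneous_mult:
  assumes "homogeneous s p" "homogeneous t q"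
  shows "homogeneous (s + t) (p * q)"
  unfolding homogeneous_def
proof
  fix m assume "m \<in> Poly_Mapping.keys (p * q)"
  then obtain a b where "m = a + b" "a \<in> Poly_Mapping.keys p" "b \<in> Poly_Mapping.keys q"
    using keys_mult[of p q] by blast
  then show "int (total_degree m) = s + t"
    using assms by (simp add: homogeneous_def total_degree_add)
qed

definition hom_part :: "int \<Rightarrow> 'k::field mpoly \<Rightarrow> 'k mpoly" where
  "hom_part t p = Abs_poly_mapping (\<lambda>m. if int (total_degree m) = t then Poly_Mapping.lookup p m else 0)"

lemma lookup_hom_part:
  "Poly_Mapping.lookup (hom_part t p) m = (if int (total_degree m) = t then Poly_Mapping.lookup p m else 0)"
proof -
  have "finite {m. (if int (total_degree m) = t then Poly_Mapping.lookup p m else 0) \<noteq> 0}"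
    by (rule finite_subset[OF _ finite_keys[of p]]) (auto simp: in_keys_iff split: if_splits)
  then show ?thesis by (simp add: hom_part_def)
qed

lemma homogeneous_hom_part: "homogeneous t (hom_part t p)"
  by (rule homogeneousI) (simp add: lookup_hom_part split: if_splits)

lemma hom_part_homogeneous: "homogeneous t p \<Longrightarrow> hom_part t p = p"
  by (rule poly_mapping_eqI) (use homogeneousD in \<open>auto simp: lookup_hom_part\<close>)

lemma hom_part_sum: "hom_part t (\<Sum>i\<in>I. f i) = (\<Sum>i\<in>I. hom_part t (f i))"
  by (rule poly_mapping_eqI) (simp add: lookup_hom_part lookup_sum)

lemma hom_part_polys: "p \<in> polys n \<Longrightarrow> hom_part t p \<in> polys n"
  by (simp add: polys_iff lookup_hom_part)

lemma hom_part_mult: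
  assumes q: "homogeneous s q"
  shows "hom_part (s + t) (q * p) = q * hom_part t p"
proof -
  have rest: "hom_part (s + t) (q * (p - hom_part t p)) = 0"
  proof (rule poly_mapping_eqI)
    fix m
    have "Poly_Mapping.lookup (q * (p - hom_part t p)) m = 0" if "int (total_degree m) = s + t"
    proof (rule ccontr)
      assume "\<not> ?thesis"
      then have "m \<in> Poly_Mapping.keys (q * (p - hom_part t p))" by (simp add: in_keys_iff)
      then obtain a b where ab: "m = a + b" "a \<in> Poly_Mapping.keys q" "b \<in> Poly_Mapping.keys (p - hom_part t p)"
        using keys_mult[of q "p - hom_part t p"] by blast
      then have "int (total_degree a) = s" using q by (simp add: homogeneous_def)
      then have "int (total_degree b) = t" using that ab(1) by (simp add: total_degree_add)
      then show False using ab(3) by (simp add: in_keys_iff lookup_minus lookup_hom_part)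
    qed
    then show "Poly_Mapping.lookup (hom_part (s + t) (q * (p - hom_part t p))) m = Poly_Mapping.lookup 0 m"
      by (simp add: lookup_hom_part)
  qed
  have "hom_part (s + t) (q * p)
      = hom_part (s + t) (q * hom_part t p) + hom_part (s + t) (q * (p - hom_part t p))"
    by (rule poly_mapping_eqI) (simp add: lookup_hom_part lookup_add algebra_simps lookup_minus)
  then show ?thesis
    using rest hom_part_homogeneous[OF homogeneous_mult[OF q homogeneous_hom_part]] by simp
qed

lemma lookup_mult_0:
  "Poly_Mapping.lookup (p * q :: 'k::field mpoly) 0 = Poly_Mapping.lookup p 0 * Poly_Mapping.lookup q 0"
proof -
  have 0: "(0 = a + b) = (a = 0 \<and> b = 0)" for a b :: "nat \<Rightarrow>\<^sub>0 nat"
  proof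
    assume "0 = a + b"
    then have "Poly_Mapping.lookup a i + Poly_Mapping.lookup b i = 0" for i
      by (metis lookup_add lookup_zero)
    then show "a = 0 \<and> b = 0" by (auto intro!: poly_mapping_eqI)
  qed simp
  have "Poly_Mapping.lookup (p * q) 0
      = (\<Sum>a. Poly_Mapping.lookup p a * (\<Sum>b. (Poly_Mapping.lookup q b when b = 0) when a = 0))"
    by (simp add: lookup_mult 0 when_when conj_commute)
  also have "\<dots> = (\<Sum>a. Poly_Mapping.lookup p a * Poly_Mapping.lookup q 0 when a = 0)"
    by (intro Sum_any.cong) (auto simp: when_def)
  finally show ?thesis by simp
qed

definition poly_mat :: "nat \<Rightarrow> nat \<Rightarrow> nat \<Rightarrow> 'k::field mpoly mat \<Rightarrow> bool" where
  "poly_mat n r r' X \<longleftrightarrow> X \<in> carrier_mat r r' \<and> (\<forall>k<r. \<forall>l<r'. X $$ (k, l) \<in> polys n)"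

definition hom_mat ::
  "nat \<Rightarrow> nat \<Rightarrow> (nat \<Rightarrow> int) \<Rightarrow> nat \<Rightarrow> (nat \<Rightarrow> int) \<Rightarrow> 'k::field mpoly mat \<Rightarrow> bool" where
  "hom_mat n r a r' a' X \<longleftrightarrow> poly_mat n r r' X \<and> (\<forall>k<r. \<forall>l<r'. homogeneous (a' l - a k) (X $$ (k, l)))"

lemma poly_mat_carrier: "poly_mat n r r' X \<Longrightarrow> X \<in> carrier_mat r r'"
  by (simp add: poly_mat_def)

lemma hom_mat_poly_mat: "hom_mat n r a r' a' X \<Longrightarrow> poly_mat n r r' X"
  by (simp add: hom_mat_def)

lemma mult_mat_entry:
  assumes "X \<in> carrier_mat r s" "Y \<in> carrier_mat s t" "k < r" "l < t"
  shows "(X * Y) $$ (k, l) = (\<Sum>m<s. X $$ (k, m) * Y $$ (m, l))"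
  using assms by (auto simp: scalar_prod_def lessThan_atLeast0 intro!: sum.cong)

lemma mult_mat_vec_entry:
  assumes "X \<in> carrier_mat r s" "v \<in> carrier_vec s" "k < r"
  shows "(X *\<^sub>v v) $ k = (\<Sum>m<s. X $$ (k, m) * v $ m)"
  using assms by (auto simp: scalar_prod_def lessThan_atLeast0 intro!: sum.cong)

lemma poly_mat_mult:
  assumes X: "poly_mat n r s X" and Y: "poly_mat n s t Y"
  shows "poly_mat n r t (X * Y)"
  unfolding poly_mat_def
proof (intro conjI allI impI)
  fix k l assume "k < r" "l < t"
  then show "(X * Y) $$ (k, l) \<in> polys n"
    using X Y by (subst mult_mat_entry[of _ r s _ t]) (auto simp: poly_mat_def intro!: polys_sum polys_mult)
qed (use X Y in \<open>auto simp: poly_mat_def\<close>)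

lemma hom_mat_mult:
  assumes X: "hom_mat n r a s b X" and Y: "hom_mat n s b t c Y"
  shows "hom_mat n r a t c (X * Y)"
  unfolding hom_mat_def
proof (intro conjI allI impI)
  show "poly_mat n r t (X * Y)" using X Y poly_mat_mult hom_mat_poly_mat by blast
  fix k l assume kl: "k < r" "l < t"
  have "homogeneous (c l - a k) (X $$ (k, m) * Y $$ (m, l))" if "m < s" for m
    using homogeneous_mult[of "b m - a k" "X $$ (k, m)" "c l - b m" "Y $$ (m, l)"] X Y kl that
    by (simp add: hom_mat_def)
  then show "homogeneous (c l - a k) ((X * Y) $$ (k, l))"
    using X Y kl by (subst mult_mat_entry[of _ r s _ t]) (auto simp: hom_mat_def poly_mat_def intro!: homogeneous_sum)
qed

lemma poly_mat_minus:
  assumes X: "poly_mat n r s X" and Y: "poly_mat n r s Y"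
  shows "poly_mat n r s (X - Y)"
  using X Y by (auto simp: poly_mat_def)

lemma poly_mat_one: "poly_mat n r r (1\<^sub>m r)"
  by (simp add: poly_mat_def)

lemma hom_mat_one: "hom_mat n r a r a (1\<^sub>m r)"
  by (auto simp: hom_mat_def poly_mat_one homogeneous_def total_degree_def)

lemma unit_vec_free_mod: "j < r \<Longrightarrow> unit_vec r j \<in> free_mod n r"
  by (auto simp: free_mod_def unit_vec_def)

lemma col_poly_mat:
  assumes "poly_mat n r s X" "j < s"
  shows "col X j \<in> free_mod n r"
  using assms by (auto simp: poly_mat_def free_mod_def)

lemma col_in_image:
  assumes X: "poly_mat n r s X" and j: "j < s"
  shows "col X j \<in> (\<lambda>v. X *\<^sub>v v) ` free_mod n s"
proof -
  have "X *\<^sub>v unit_vec s j = col X j"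
  proof (rule eq_vecI)
    fix k assume "k < dim_vec (col X j)"
    then have k: "k < r" using carrier_matD(1)[OF poly_mat_carrier[OF X]] by simp
    have "(X *\<^sub>v unit_vec s j) $ k = (\<Sum>m<s. if m = j then X $$ (k, m) else 0)"
      unfolding mult_mat_vec_entry[OF poly_mat_carrier[OF X] unit_vec_carrier k]
      using j by (intro sum.cong) (auto simp: unit_vec_def)
    then show "(X *\<^sub>v unit_vec s j) $ k = col X j $ k"
      using j k poly_mat_carrier[OF X] by simp
  qed (use X in \<open>auto simp: poly_mat_def\<close>)
  then show ?thesis using unit_vec_free_mod[OF j] by (metis image_eqI)
qed

lemma lift_poly_mat:
  assumes D: "poly_mat n r s D" and X: "X \<in> carrier_mat r t"
    and cols: "\<And>j. j < t \<Longrightarrow> col X j \<in> (\<lambda>v. D *\<^sub>v v) ` free_mod n s"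
  shows "\<exists>Y. poly_mat n s t Y \<and> D * Y = X"
proof -
  have "\<forall>j\<in>{..<t}. \<exists>w. w \<in> free_mod n s \<and> col X j = D *\<^sub>v w" using cols by blast
  then obtain w where w: "\<forall>j\<in>{..<t}. w j \<in> free_mod n s \<and> col X j = D *\<^sub>v w j"
    by (rule bchoice[THEN exE])
  define Y where "Y = mat s t (\<lambda>(k, j). w j $ k)"
  have Y: "poly_mat n s t Y" using w by (auto simp: poly_mat_def Y_def free_mod_def)
  have colY: "col Y j = w j" if "j < t" for j
  proof -
    have "dim_vec (w j) = s" using w that by (auto simp: free_mod_def)
    then show ?thesis using that by (intro eq_vecI) (auto simp: Y_def)
  qed
  have "D * Y = X"
  proof (rule mat_col_eqI)
    fix j assume "j < dim_col X"
    then have j: "j < t" using X by simp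
    have "col (D * Y) j = D *\<^sub>v col Y j"
      using poly_mat_carrier[OF D] poly_mat_carrier[OF Y] j by (rule col_mult2)
    then show "col (D * Y) j = col X j" using colY[OF j] w j by simp
  qed (use X D Y in \<open>auto simp: poly_mat_def\<close>)
  then show ?thesis using Y by blast
qed

text \<open>The lift of each column is arbitrary at first; passing to its homogeneous parts of the right
  degrees keeps it a lift, because \<open>D\<close> and \<open>X\<close> are homogeneous.\<close>

lemma lift_hom_mat:
  assumes D: "hom_mat n r a s b D" and X: "hom_mat n r a t c X"
    and cols: "\<And>j. j < t \<Longrightarrow> col X j \<in> (\<lambda>v. D *\<^sub>v v) ` free_mod n s"
  shows "\<exists>Y. hom_mat n s b t c Y \<and> D * Y = X"
proof -
  have Dc: "D \<in> carrier_mat r s" and Xc: "X \<in> carrier_mat r t"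
    using D X by (auto simp: hom_mat_def poly_mat_def)
  obtain Y where Y: "poly_mat n s t Y" "D * Y = X"
    using lift_poly_mat[OF hom_mat_poly_mat[OF D] Xc cols] by blast
  have Yc: "Y \<in> carrier_mat s t" using Y(1) by (rule poly_mat_carrier)
  define Z where "Z = mat s t (\<lambda>(k, j). hom_part (c j - b k) (Y $$ (k, j)))"
  have Zc: "Z \<in> carrier_mat s t" by (simp add: Z_def)
  have "hom_mat n s b t c Z"
    using Y(1) by (auto simp: hom_mat_def poly_mat_def Z_def hom_part_polys homogeneous_hom_part)
  moreover have "D * Z = X"
  proof (rule eq_matI)
    fix k j assume "k < dim_row X" "j < dim_col X"
    then have kj: "k < r" "j < t" using Xc by auto
    have "D $$ (k, m) * Z $$ (m, j) = hom_part (c j - a k) (D $$ (k, m) * Y $$ (m, j))" if "m < s" for m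
      using hom_part_mult[of "b m - a k" "D $$ (k, m)" "c j - b m" "Y $$ (m, j)"] D kj that
      by (simp add: hom_mat_def Z_def)
    then have "(D * Z) $$ (k, j) = hom_part (c j - a k) ((D * Y) $$ (k, j))"
      using mult_mat_entry[OF Dc Zc kj] mult_mat_entry[OF Dc Yc kj] by (simp add: hom_part_sum)
    also have "\<dots> = X $$ (k, j)"
      unfolding Y(2) using X kj by (intro hom_part_homogeneous) (simp add: hom_mat_def)
    finally show "(D * Z) $$ (k, j) = X $$ (k, j)" .
  qed (use Dc Zc Xc in auto)
  ultimately show ?thesis by blast
qed

text \<open>A minimal resolution together with its augmentation as the map \<open>D 0\<close>. The latter is
  exempt from the minimality condition.\<close>

locale minimal_exact_complex =
  fixes n :: nat and R :: "nat \<Rightarrow> nat" and a :: "nat \<Rightarrow> nat \<Rightarrow> int" and D :: "nat \<Rightarrow> 'k::field mpoly mat"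
  assumes hom: "hom_mat n (R i) (a i) (R (Suc i)) (a (Suc i)) (D i)"
    and exact: "{v \<in> free_mod n (R (Suc i)). D i *\<^sub>v v = 0\<^sub>v (R i)}
      = (\<lambda>v. D (Suc i) *\<^sub>v v) ` free_mod n (R (Suc (Suc i)))"
    and minimal: "k < R (Suc i) \<Longrightarrow> l < R (Suc (Suc i)) \<Longrightarrow> Poly_Mapping.lookup (D (Suc i) $$ (k, l)) 0 = 0"
begin

lemma D_poly: "poly_mat n (R i) (R (Suc i)) (D i)"
  using hom by (rule hom_mat_poly_mat)

lemma D_carrier: "D i \<in> carrier_mat (R i) (R (Suc i))"
  using D_poly by (rule poly_mat_carrier)

lemma in_image_if_kernel:
  assumes X: "poly_mat n (R (Suc i)) t X" and "D i * X = 0\<^sub>m (R i) t" and j: "j < t"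
  shows "col X j \<in> (\<lambda>v. D (Suc i) *\<^sub>v v) ` free_mod n (R (Suc (Suc i)))"
proof -
  have "D i *\<^sub>v col X j = col (D i * X) j"
    using col_mult2[OF D_carrier poly_mat_carrier[OF X] j] by simp
  also have "\<dots> = 0\<^sub>v (R i)" using assms(2) j by simp
  finally show ?thesis unfolding exact[symmetric] using col_poly_mat[OF X j] by blast
qed

lemma D_D: "D i * D (Suc i) = 0\<^sub>m (R i) (R (Suc (Suc i)))"
proof (rule mat_col_eqI)
  fix j assume "j < dim_col (0\<^sub>m (R i) (R (Suc (Suc i))) :: 'k mpoly mat)"
  then have j: "j < R (Suc (Suc i))" by simp
  have "col (D (Suc i)) j \<in> {v \<in> free_mod n (R (Suc i)). D i *\<^sub>v v = 0\<^sub>v (R i)}"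
    unfolding exact by (rule col_in_image[OF D_poly j])
  then show "col (D i * D (Suc i)) j = col (0\<^sub>m (R i) (R (Suc (Suc i)))) j"
    using col_mult2[OF D_carrier D_carrier j] j by simp
qed (use D_carrier[of i] D_carrier[of "Suc i"] in auto)

text \<open>A chain endomorphism \<open>T\<close> that vanishes at the bottom is null-homotopic, \<open>T (Suc
  i) = h * D i + D (Suc i) * h'\<close>, and the matrices \<open>D\<close> have entries in the
  irrelevant ideal. The matrix \<open>D 0\<close> is an exception, but there the homotopy
  \<open>h\<close> is zero.\<close>

lemma null_homotopic_mod_irrelevant:
  assumes T: "\<And>i. poly_mat n (R i) (R i) (T i)" and T0: "T 0 = 0\<^sub>m (R 0) (R 0)"
    and comm: "\<And>i. D i * T (Suc i) = T i * D i"
    and kl: "k < R (Suc i)" "l < R (Suc i)"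
  shows "Poly_Mapping.lookup (T (Suc i) $$ (k, l)) 0 = 0"
proof -
  note Dc = D_carrier
  note Tc = poly_mat_carrier[OF T]
  have step: "\<exists>h'. poly_mat n (R (Suc (Suc i))) (R (Suc i)) h' \<and> D (Suc i) * h' = T (Suc i) - h * D i"
    if h: "poly_mat n (R (Suc i)) (R i) h" "D i * h * D i = T i * D i" for h i
  proof (rule lift_poly_mat[OF D_poly])
    have hc: "h \<in> carrier_mat (R (Suc i)) (R i)" using h(1) by (rule poly_mat_carrier)
    have X: "poly_mat n (R (Suc i)) (R (Suc i)) (T (Suc i) - h * D i)"
      by (intro poly_mat_minus T poly_mat_mult[OF h(1) D_poly])
    then show "T (Suc i) - h * D i \<in> carrier_mat (R (Suc i)) (R (Suc i))" by (rule poly_mat_carrier)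
    have hD: "h * D i \<in> carrier_mat (R (Suc i)) (R (Suc i))" using hc Dc[of i] by simp
    have "D i * (T (Suc i) - h * D i) = D i * T (Suc i) - D i * (h * D i)"
      by (rule mult_minus_distrib_mat[OF Dc Tc hD])
    also have "\<dots> = T i * D i - T i * D i"
      using h(2) assoc_mult_mat[OF Dc hc Dc[of i]] comm by simp
    also have "\<dots> = 0\<^sub>m (R i) (R (Suc i))"
      using mult_carrier_mat[OF Tc Dc] by (rule minus_r_inv_mat)
    finally show "col (T (Suc i) - h * D i) j \<in> (\<lambda>v. D (Suc i) *\<^sub>v v) ` free_mod n (R (Suc (Suc i)))"
      if "j < R (Suc i)" for j
      using in_image_if_kernel[OF X] that by blast
  qed
  have ex: "\<exists>h. poly_mat n (R (Suc i)) (R i) h \<and> D i * h * D i = T i * D i \<and>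
      (i = 0 \<longrightarrow> h = 0\<^sub>m (R 1) (R 0))" for i
  proof (induction i)
    case 0
    show ?case
      by (rule exI[of _ "0\<^sub>m (R 1) (R 0)"]) (use Dc[of 0] T0 in \<open>auto simp: poly_mat_def\<close>)
  next
    case (Suc i)
    then obtain h where h: "poly_mat n (R (Suc i)) (R i) h" "D i * h * D i = T i * D i" by blast
    obtain h' where h': "poly_mat n (R (Suc (Suc i))) (R (Suc i)) h'" "D (Suc i) * h' = T (Suc i) - h * D i"
      using step[OF h] by blast
    have hc: "h \<in> carrier_mat (R (Suc i)) (R i)" using h(1) by (rule poly_mat_carrier)
    have hD: "h * D i \<in> carrier_mat (R (Suc i)) (R (Suc i))" using hc Dc[of i] by simp
    have "D (Suc i) * h' * D (Suc i) = T (Suc i) * D (Suc i) - h * D i * D (Suc i)"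
      unfolding h'(2) by (rule minus_mult_distrib_mat[OF Tc hD Dc])
    also have "h * D i * D (Suc i) = 0\<^sub>m (R (Suc i)) (R (Suc (Suc i)))"
      using assoc_mult_mat[OF hc Dc Dc[of "Suc i"]] D_D hc by simp
    also have "T (Suc i) * D (Suc i) - 0\<^sub>m (R (Suc i)) (R (Suc (Suc i))) = T (Suc i) * D (Suc i)"
      by (intro eq_matI) (auto simp: carrier_matD[OF Tc] carrier_matD[OF Dc])
    finally show ?case using h' by blast
  qed
  obtain h where h: "poly_mat n (R (Suc i)) (R i) h" "D i * h * D i = T i * D i" "i = 0 \<longrightarrow> h = 0\<^sub>m (R 1) (R 0)"
    using ex by blast
  obtain h' where h': "poly_mat n (R (Suc (Suc i))) (R (Suc i)) h'" "D (Suc i) * h' = T (Suc i) - h * D i"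
    using step[OF h(1,2)] by blast
  have hc: "h \<in> carrier_mat (R (Suc i)) (R i)" and h'c: "h' \<in> carrier_mat (R (Suc (Suc i))) (R (Suc i))"
    using h(1) h'(1) by (auto intro: poly_mat_carrier)
  have hD: "h * D i \<in> carrier_mat (R (Suc i)) (R (Suc i))" using hc Dc[of i] by simp
  have "(D (Suc i) * h') $$ (k, l) = T (Suc i) $$ (k, l) - (h * D i) $$ (k, l)"
    unfolding h'(2) using kl by (simp add: carrier_matD[OF hc] carrier_matD[OF Dc])
  moreover have "Poly_Mapping.lookup ((D (Suc i) * h') $$ (k, l)) 0 = 0"
    using kl by (subst mult_mat_entry[OF Dc h'c]) (auto simp: lookup_sum lookup_mult_0 minimal)
  moreover have "Poly_Mapping.lookup ((h * D i) $$ (k, l)) 0 = 0"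
  proof (cases i)
    case 0
    then show ?thesis using h(3) kl Dc[of 0] by simp
  next
    case (Suc i')
    then have "Poly_Mapping.lookup (D i $$ (m, l)) 0 = 0" if "m < R i" for m
      using minimal[of m i' l] that kl by simp
    then show ?thesis
      using kl by (subst mult_mat_entry[OF hc Dc]) (auto simp: lookup_sum lookup_mult_0)
  qed
  ultimately show ?thesis by (simp add: lookup_minus)
qed

end

text \<open>The comparison theorem for resolutions, with homogeneous lifts.\<close>

lemma chain_map_exists:
  assumes F: "minimal_exact_complex n R a D" and G: "minimal_exact_complex n R' a' D'"
    and bottom: "R 0 = 1" "R' 0 = 1" "a 0 = a' 0"
    and image: "(\<lambda>v. D 0 *\<^sub>v v) ` free_mod n (R 1) = (\<lambda>v. D' 0 *\<^sub>v v) ` free_mod n (R' 1)"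
  shows "\<exists>\<Phi>. \<Phi> 0 = 1\<^sub>m 1 \<and> (\<forall>i. hom_mat n (R' i) (a' i) (R i) (a i) (\<Phi> i) \<and>
            D' i * \<Phi> (Suc i) = \<Phi> i * D i)"
proof -
  interpret F: minimal_exact_complex n R a D by (rule F)
  interpret G: minimal_exact_complex n R' a' D' by (rule G)
  define P where "P i \<phi> \<longleftrightarrow> (i = 0 \<longrightarrow> \<phi> = 1\<^sub>m 1) \<and> hom_mat n (R' i) (a' i) (R i) (a i) \<phi> \<and>
      (\<forall>j<R (Suc i). col (\<phi> * D i) j \<in> (\<lambda>v. D' i *\<^sub>v v) ` free_mod n (R' (Suc i)))" for i \<phi>
  have "\<exists>\<Phi>. \<forall>i. P i (\<Phi> i) \<and> D' i * \<Phi> (Suc i) = \<Phi> i * D i"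
  proof (rule dependent_nat_choice)
    have "1\<^sub>m 1 * D 0 = D 0" using F.D_carrier[of 0] bottom by simp
    moreover have "hom_mat n (R' 0) (a' 0) (R 0) (a 0) (1\<^sub>m 1)"
      using hom_mat_one[of n 1 "a 0"] bottom by simp
    ultimately have "P 0 (1\<^sub>m 1)"
      using col_in_image[OF F.D_poly[of 0]] image by (simp add: P_def)
    then show "\<exists>\<phi>. P 0 \<phi>" by blast
    fix \<phi> i assume P: "P i \<phi>"
    then have \<phi>: "hom_mat n (R' i) (a' i) (R i) (a i) \<phi>" by (simp add: P_def)
    obtain \<psi> where \<psi>: "hom_mat n (R' (Suc i)) (a' (Suc i)) (R (Suc i)) (a (Suc i)) \<psi>" "D' i * \<psi> = \<phi> * D i"
      using lift_hom_mat[OF G.hom hom_mat_mult[OF \<phi> F.hom]] P by (auto simp: P_def)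
    have \<phi>c: "\<phi> \<in> carrier_mat (R' i) (R i)" and \<psi>c: "\<psi> \<in> carrier_mat (R' (Suc i)) (R (Suc i))"
      using \<phi> \<psi>(1) by (auto simp: hom_mat_def poly_mat_def)
    have "D' i * (\<psi> * D (Suc i)) = \<phi> * D i * D (Suc i)"
      using assoc_mult_mat[OF G.D_carrier \<psi>c F.D_carrier] \<psi>(2) by simp
    also have "\<dots> = 0\<^sub>m (R' i) (R (Suc (Suc i)))"
      using assoc_mult_mat[OF \<phi>c F.D_carrier F.D_carrier] F.D_D \<phi>c by simp
    finally have "P (Suc i) \<psi>"
      using G.in_image_if_kernel[OF poly_mat_mult[OF hom_mat_poly_mat[OF \<psi>(1)] F.D_poly]] \<psi>(1)
      by (simp add: P_def)
    then show "\<exists>\<psi>. P (Suc i) \<psi> \<and> D' i * \<psi> = \<phi> * D i" using \<psi>(2) by blast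
  qed
  then show ?thesis unfolding P_def by blast
qed

text \<open>If there were more rows than columns, padding with zeros would give a square matrix with a
  one-sided inverse and a zero row.\<close>

lemma card_le_if_left_inverse:
  fixes X Y :: "nat \<Rightarrow> nat \<Rightarrow> 'k::field"
  assumes fin: "finite J" "finite J'"
    and XY: "\<And>k l. k \<in> J \<Longrightarrow> l \<in> J \<Longrightarrow> (\<Sum>m\<in>J'. X k m * Y m l) = (if k = l then 1 else 0)"
  shows "card J \<le> card J'"
proof (rule ccontr)
  assume less: "\<not> ?thesis"
  obtain f where f: "bij_betw f {0..<card J} J" using ex_bij_betw_nat_finite[OF fin(1)] by blast
  obtain f' where f': "bij_betw f' {0..<card J'} J'" using ex_bij_betw_nat_finite[OF fin(2)] by blast
  let ?N = "card J"
  define X' where "X' = mat ?N ?N (\<lambda>(k, m). if m < card J' then X (f k) (f' m) else 0)"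
  define Y' where "Y' = mat ?N ?N (\<lambda>(m, l). if m < card J' then Y (f' m) (f l) else 0)"
  have c: "X' \<in> carrier_mat ?N ?N" "Y' \<in> carrier_mat ?N ?N" by (simp_all add: X'_def Y'_def)
  have "X' * Y' = 1\<^sub>m ?N"
  proof (rule eq_matI)
    fix k l assume "k < dim_row (1\<^sub>m ?N :: 'k mat)" "l < dim_col (1\<^sub>m ?N :: 'k mat)"
    then have kl: "k < ?N" "l < ?N" by auto
    have "(X' * Y') $$ (k, l) = (\<Sum>m\<in>{0..<?N}. X' $$ (k, m) * Y' $$ (m, l))"
      using kl c by (auto simp: scalar_prod_def intro!: sum.cong)
    also have "\<dots> = (\<Sum>m\<in>{0..<card J'}. X (f k) (f' m) * Y (f' m) (f l))"
      using less kl by (intro sum.mono_neutral_cong_right) (auto simp: X'_def Y'_def)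
    also have "\<dots> = (\<Sum>m\<in>J'. X (f k) m * Y m (f l))"
      by (rule sum.reindex_bij_betw[OF f'])
    also have "\<dots> = (if f k = f l then 1 else 0)"
      using bij_betwE[OF f] kl by (intro XY) auto
    also have "f k = f l \<longleftrightarrow> k = l"
      using f kl by (auto simp: bij_betw_def inj_on_def)
    finally show "(X' * Y') $$ (k, l) = 1\<^sub>m ?N $$ (k, l)" using kl by simp
  qed (use c in auto)
  then have "Y' * X' = 1\<^sub>m ?N" by (rule mat_mult_left_right_inverse[OF c])
  moreover have "(Y' * X') $$ (card J', card J') = 0"
    using less c by (auto simp: scalar_prod_def Y'_def)
  ultimately show False using less by simp
qed

text \<open>The composite of the comparison maps is homotopic to the identity, so their constant terms are
  mutually inverse matrices over the field. By homogeneity a constant term is nonzero only between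
  basis elements of equal degree, so the argument applies in each degree separately.\<close>

lemma minimal_complex_count_le:
  assumes F: "minimal_exact_complex n R a D" and G: "minimal_exact_complex n R' a' D'"
    and bottom: "R 0 = 1" "R' 0 = 1" "a 0 = a' 0"
    and image: "(\<lambda>v. D 0 *\<^sub>v v) ` free_mod n (R 1) = (\<lambda>v. D' 0 *\<^sub>v v) ` free_mod n (R' 1)"
  shows "card {k. k < R (Suc i) \<and> a (Suc i) k = j} \<le> card {k. k < R' (Suc i) \<and> a' (Suc i) k = j}"
proof -
  interpret F: minimal_exact_complex n R a D by (rule F)
  interpret G: minimal_exact_complex n R' a' D' by (rule G)
  obtain \<Phi> where \<Phi>0: "\<Phi> 0 = 1\<^sub>m 1" and \<Phi>: "\<And>i. hom_mat n (R' i) (a' i) (R i) (a i) (\<Phi> i)"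
    "\<And>i. D' i * \<Phi> (Suc i) = \<Phi> i * D i"
    using chain_map_exists[OF F G bottom image] by blast
  obtain \<Psi> where \<Psi>0: "\<Psi> 0 = 1\<^sub>m 1" and \<Psi>: "\<And>i. hom_mat n (R i) (a i) (R' i) (a' i) (\<Psi> i)"
    "\<And>i. D i * \<Psi> (Suc i) = \<Psi> i * D' i"
    using chain_map_exists[OF G F bottom(2,1) bottom(3)[symmetric] image[symmetric]] by blast
  have \<Phi>c: "\<Phi> i \<in> carrier_mat (R' i) (R i)" and \<Psi>c: "\<Psi> i \<in> carrier_mat (R i) (R' i)" for i
    using \<Phi>(1)[of i] \<Psi>(1)[of i] by (auto simp: hom_mat_def poly_mat_def)
  define T where "T i = \<Psi> i * \<Phi> i - 1\<^sub>m (R i)" for i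
  have \<Psi>\<Phi>: "\<Psi> i * \<Phi> i \<in> carrier_mat (R i) (R i)" for i using \<Phi>c[of i] \<Psi>c[of i] by simp
  have T: "poly_mat n (R i) (R i) (T i)" for i
    unfolding T_def
    by (intro poly_mat_minus poly_mat_one poly_mat_mult[OF hom_mat_poly_mat[OF \<Psi>(1)] hom_mat_poly_mat[OF \<Phi>(1)]])
  have T0: "T 0 = 0\<^sub>m (R 0) (R 0)"
    using \<Phi>0 \<Psi>0 bottom by (simp add: T_def)
  have comm: "D i * T (Suc i) = T i * D i" for i
  proof -
    have "D i * T (Suc i) = D i * (\<Psi> (Suc i) * \<Phi> (Suc i)) - D i"
      unfolding T_def using mult_minus_distrib_mat[OF F.D_carrier \<Psi>\<Phi> one_carrier_mat] F.D_carrier[of i] by simp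
    also have "D i * (\<Psi> (Suc i) * \<Phi> (Suc i)) = \<Psi> i * D' i * \<Phi> (Suc i)"
      using assoc_mult_mat[OF F.D_carrier \<Psi>c \<Phi>c] \<Psi>(2) by simp
    also have "\<dots> = \<Psi> i * (\<Phi> i * D i)"
      using assoc_mult_mat[OF \<Psi>c G.D_carrier \<Phi>c] \<Phi>(2) by simp
    also have "\<dots> = \<Psi> i * \<Phi> i * D i"
      using assoc_mult_mat[OF \<Psi>c \<Phi>c F.D_carrier] by simp
    also have "\<dots> - D i = T i * D i"
      unfolding T_def using minus_mult_distrib_mat[OF \<Psi>\<Phi> one_carrier_mat F.D_carrier] F.D_carrier[of i] by simp
    finally show ?thesis .
  qed
  define X where "X k m = Poly_Mapping.lookup (\<Psi> (Suc i) $$ (k, m)) 0" for k m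
  define Y where "Y m l = Poly_Mapping.lookup (\<Phi> (Suc i) $$ (m, l)) 0" for m l
  let ?J = "{k. k < R (Suc i) \<and> a (Suc i) k = j}" and ?J' = "{k. k < R' (Suc i) \<and> a' (Suc i) k = j}"
  show ?thesis
  proof (rule card_le_if_left_inverse[of ?J ?J' X Y])
    fix k l assume kl: "k \<in> ?J" "l \<in> ?J"
    have X0: "X k m = 0" if "m < R' (Suc i)" "m \<notin> ?J'" for m
    proof (rule ccontr)
      assume nz: "X k m \<noteq> 0"
      have "homogeneous (a' (Suc i) m - a (Suc i) k) (\<Psi> (Suc i) $$ (k, m))"
        using \<Psi>(1)[of "Suc i"] kl(1) that(1) unfolding hom_mat_def by blast
      from homogeneousD[OF this nz[unfolded X_def]] have "a' (Suc i) m = a (Suc i) k"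
        by (simp add: total_degree_def)
      then show False using kl that by simp
    qed
    have "Poly_Mapping.lookup (T (Suc i) $$ (k, l)) 0 = 0"
      using F.null_homotopic_mod_irrelevant[OF T T0 comm] kl by simp
    then have "Poly_Mapping.lookup ((\<Psi> (Suc i) * \<Phi> (Suc i)) $$ (k, l)) 0 = (if k = l then 1 else 0)"
      using kl \<Psi>\<Phi>[of "Suc i"] by (auto simp: T_def lookup_minus split: if_splits)
    then have "(\<Sum>m<R' (Suc i). X k m * Y m l) = (if k = l then 1 else 0)"
      using mult_mat_entry[OF \<Psi>c \<Phi>c, of k "Suc i" l] kl by (simp add: lookup_sum lookup_mult_0 X_def Y_def)
    moreover have "(\<Sum>m<R' (Suc i). X k m * Y m l) = (\<Sum>m\<in>?J'. X k m * Y m l)"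
      by (rule sum.mono_neutral_right) (use X0 in auto)
    ultimately show "(\<Sum>m\<in>?J'. X k m * Y m l) = (if k = l then 1 else 0)" by simp
  qed auto
qed

lemma minimal_resolution_augmented:
  assumes "minimal_graded_free_resolution n I r a e d"
  defines "R \<equiv> case_nat 1 r" and "b \<equiv> case_nat (\<lambda>_. 0) a"
    and "D \<equiv> case_nat (mat 1 (r 0) (\<lambda>(_, k). e $ k)) d"
  shows "minimal_exact_complex n R b D"
    and "(\<lambda>v. D 0 *\<^sub>v v) ` free_mod n (R 1) = (\<lambda>p. vec 1 (\<lambda>_. p)) ` I"
proof -
  note F = assms(1)[unfolded minimal_graded_free_resolution_def graded_free_resolution_def]
  have e: "e \<in> free_mod n (r 0)" and e_hom: "\<forall>k<r 0. homogeneous (a 0 k) (e $ k)"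
    using F by - (elim conjE, assumption)+
  have d_all: "\<forall>i. d i \<in> carrier_mat (r i) (r (Suc i)) \<and> (\<forall>k<r i. \<forall>l<r (Suc i).
      d i $$ (k, l) \<in> polys n \<and> homogeneous (a (Suc i) l - a i k) (d i $$ (k, l)))"
    using F by (elim conjE) assumption
  have d: "d i \<in> carrier_mat (r i) (r (Suc i))"
    "\<forall>k<r i. \<forall>l<r (Suc i). d i $$ (k, l) \<in> polys n \<and> homogeneous (a (Suc i) l - a i k) (d i $$ (k, l))" for i
    using d_all by simp_all
  have d_irr: "\<forall>k<r i. \<forall>l<r (Suc i). d i $$ (k, l) \<in> irrelevant_ideal n" for i
    using F by (elim conjE) simp
  have im: "(\<lambda>v. e \<bullet> v) ` free_mod n (r 0) = I"
    using F by (elim conjE) assumption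
  have ex0: "{v \<in> free_mod n (r 0). e \<bullet> v = 0} = (\<lambda>v. d 0 *\<^sub>v v) ` free_mod n (r 1)"
    using F by (elim conjE) assumption
  have ex: "{v \<in> free_mod n (r (Suc i)). d i *\<^sub>v v = 0\<^sub>v (r i)} =
        (\<lambda>v. d (Suc i) *\<^sub>v v) ` free_mod n (r (Suc (Suc i)))" for i
    using F by (elim conjE) (erule spec)
  have e_mult: "D 0 *\<^sub>v v = vec 1 (\<lambda>_. e \<bullet> v)" if "v \<in> free_mod n (r 0)" for v
    using that e by (intro eq_vecI) (auto simp: D_def scalar_prod_def free_mod_def intro!: sum.cong)
  have vec1: "vec 1 (\<lambda>_. p) = (0\<^sub>v 1 :: 'a mpoly vec) \<longleftrightarrow> p = 0" for p
    by (auto simp: vec_eq_iff)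
  show "minimal_exact_complex n R b D"
  proof
    fix i
    show "hom_mat n (R i) (b i) (R (Suc i)) (b (Suc i)) (D i)"
    proof (cases i)
      case 0
      then show ?thesis using e e_hom by (simp add: R_def b_def D_def hom_mat_def poly_mat_def free_mod_def)
    next
      case (Suc i')
      then show ?thesis using d by (simp add: R_def b_def D_def hom_mat_def poly_mat_def)
    qed
    show "{v \<in> free_mod n (R (Suc i)). D i *\<^sub>v v = 0\<^sub>v (R i)} =
        (\<lambda>v. D (Suc i) *\<^sub>v v) ` free_mod n (R (Suc (Suc i)))"
    proof (cases i)
      case 0
      have "{v \<in> free_mod n (r 0). D 0 *\<^sub>v v = 0\<^sub>v 1} = {v \<in> free_mod n (r 0). e \<bullet> v = 0}"
        using e_mult vec1 by auto
      then show ?thesis using 0 ex0 by (simp add: R_def D_def)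
    next
      case (Suc i')
      then show ?thesis using ex[of i'] by (simp add: R_def D_def)
    qed
    show "Poly_Mapping.lookup (D (Suc i) $$ (k, l)) 0 = 0" if "k < R (Suc i)" "l < R (Suc (Suc i))" for k l
      using d_irr[of i] that by (simp add: R_def D_def irrelevant_ideal_eq)
  qed
  show "(\<lambda>v. D 0 *\<^sub>v v) ` free_mod n (R 1) = (\<lambda>p. vec 1 (\<lambda>_. p)) ` I"
    using e_mult unfolding im[symmetric] by (auto simp: R_def image_image)
qed

lemma minimal_resolution_count_le:
  assumes F: "minimal_graded_free_resolution n I r a e d" and G: "minimal_graded_free_resolution n I r' a' e' d'"
  shows "card {k. k < r i \<and> a i k = j} \<le> card {k. k < r' i \<and> a' i k = j}"
  using minimal_complex_count_le[OF minimal_resolution_augmented(1)[OF F] minimal_resolution_augmented(1)[OF G], of i j]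
    minimal_resolution_augmented(2)[OF F] minimal_resolution_augmented(2)[OF G]
  by simp

theorem graded_betti_eq:
  assumes F: "minimal_graded_free_resolution n I r a e d"
  shows "graded_betti n I i j = card {k. k < r i \<and> a i k = j}"
  unfolding graded_betti_def
proof (rule the_equality)
  show "\<exists>r' a' e' d'. minimal_graded_free_resolution n I r' a' e' d' \<and>
      card {k. k < r i \<and> a i k = j} = card {k. k < r' i \<and> a' i k = j}"
    using F by blast
  fix b assume "\<exists>r' a' e' d'. minimal_graded_free_resolution n I r' a' e' d' \<and> b = card {k. k < r' i \<and> a' i k = j}"
  then obtain r' a' e' d' where G: "minimal_graded_free_resolution n I r' a' e' d'"
    and b: "b = card {k. k < r' i \<and> a' i k = j}" by blast
  show "b = card {k. k < r i \<and> a i k = j}"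
    unfolding b using minimal_resolution_count_le[OF F G] minimal_resolution_count_le[OF G F] by (rule antisym[rotated])
qed

section \<open>Regularity and flips\<close>

text \<open>A Betti number in homological degree \<open>i\<close> and squarefree degree \<open>W\<close>
  contributes \<open>card W - i\<close> to the regularity, which is exactly the size at which the
  cochain complex on \<open>W\<close> fails to be exact.\<close>

theorem regularity_circuit_ideal:
  assumes \<D>: "\<And>F. F \<in> \<D> \<Longrightarrow> F \<subseteq> {1..n}"
  shows "regularity n (circuit_ideal n \<D> :: 'k::field mpoly set)
    = Sup ((\<lambda>s. ereal (real s)) ` nonexact_degrees TYPE('k) n \<D>)"
proof -
  obtain M r A g where "squarefree_resolution n 1 M r A (g :: nat \<Rightarrow> nat \<Rightarrow> nat \<Rightarrow> 'k)"
    and M0: "M 0 = ideal_system \<D>"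
    using squarefree_resolution_exists[OF nested_ideal_system] by blast
  then interpret squarefree_resolution n 1 M r A g by simp
  have betti: "graded_betti n (circuit_ideal n \<D> :: 'k mpoly set) i j \<noteq> 0 \<longleftrightarrow>
      (\<exists>k<r i. int (card (A i k)) = j)" for i j
  proof -
    have "finite {k. k < r i \<and> int (card (A i k)) = j}" by simp
    then show ?thesis
      by (auto simp: graded_betti_eq[OF minimal_graded_free_resolution_circuit_ideal[OF M0 \<D>]])
  qed
  have generator: "(\<exists>k<r i. A i k = W) \<longleftrightarrow> i \<le> card W \<and> \<not> relative_exact TYPE('k) \<D> W (card W - i)"
    if "W \<subseteq> {1..n}" for W i
    using generator_iff_not_exact[OF that] koszul_exact_ideal_system[OF finite_subset[OF that], where ?'k = 'k]
    by (simp add: M0)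
  have "{ereal (real_of_int (j - int i)) | i j. \<exists>k<r i. int (card (A i k)) = j}
      = (\<lambda>s. ereal (real s)) ` nonexact_degrees TYPE('k) n \<D>" (is "?L = ?R")
  proof (intro equalityI subsetI)
    fix x assume "x \<in> ?L"
    then obtain i k where k: "k < r i" "x = ereal (real_of_int (int (card (A i k)) - int i))" by blast
    then have "i \<le> card (A i k)" "\<not> relative_exact TYPE('k) \<D> (A i k) (card (A i k) - i)"
      using generator[OF A_subset[OF k(1)], of i] by blast+
    then have "card (A i k) - i \<in> nonexact_degrees TYPE('k) n \<D>" "x = ereal (real (card (A i k) - i))"
      using A_subset[OF k(1)] k(2) by (auto simp: nonexact_degrees_def of_nat_diff)
    then show "x \<in> ?R" by blast
  next
    fix x assume "x \<in> ?R"
    then obtain s W where x: "x = ereal (real s)"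
      and W: "W \<subseteq> {1..n}" "s \<le> card W" "\<not> relative_exact TYPE('k) \<D> W s"
      unfolding nonexact_degrees_def by blast
    then obtain k where "k < r (card W - s)" "A (card W - s) k = W"
      using generator[OF W(1), of "card W - s"] by auto
    moreover have "x = ereal (real_of_int (int (card W) - int (card W - s)))"
      using x W(2) by (simp add: of_nat_diff)
    ultimately show "x \<in> ?L"
      by (intro CollectI exI[of _ "int (card W)"] exI[of _ "card W - s"] conjI exI[of _ k]) simp_all
  qed
  then show ?thesis by (simp only: regularity_def betti)
qed

theorem corollary3p12:
  fixes n :: nat and C C' :: "nat set set"
  assumes "uniform3_clutter n C"
    and "is_flip C C'"
  shows "regularity n (circuit_ideal n (clutter_complement n C) :: 'k::field mpoly set) =
         regularity n (circuit_ideal n (clutter_complement n C') :: 'k mpoly set)"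
proof -
  have "F \<subseteq> {1..n}" if "F \<in> clutter_complement n X" for F X
    using that by (simp add: clutter_complement_def triples_def)
  then show ?thesis
    by (simp add: regularity_circuit_ideal nonexact_degrees_flip[OF assms])
qed

end
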